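(* Let $G$ be a simple connected graph on at least $2$ vertices. Then $$Q(G)> \sqrt{e},$$ where $e$ is the base of the natural logarithm.
   Context: All graphs are finite. For a connected graph $G=(V,E)$, $F(G)$ denotes the number of spanning forests of $G$, that is, the number of edge subsets $A\subseteq E$ containing no cycle (the empty set included), $T(G)$ denotes the number of spanning trees of $G$, and $Q(G)=\frac{F(G)}{T(G)}$. *)

theory Defs
  imports Complex_Main
begin

text \<open>A graph is given by its vertex set \<open>V\<close> and its set \<open>E\<close> of undirected edges, each a
  two-element set of vertices.  The trees and forests of AFP Graph_Theory are directed
  (an edge together with its reverse arc is a cycle there), so they are not used here.\<close>

definition simple_graph :: "'a set \<Rightarrow> 'a set set \<Rightarrow> bool" where
  "simple_graph V E \<longleftrightarrow> finite V \<and> (\<forall>e\<in>E. e \<subseteq> V \<and> card e = 2)"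

definition graph_connected :: "'a set \<Rightarrow> 'a set set \<Rightarrow> bool" where
  "graph_connected V E \<longleftrightarrow>
     V \<noteq> {} \<and> (\<forall>u\<in>V. \<forall>v\<in>V. (u, v) \<in> {(x, y). {x, y} \<in> E}\<^sup>*)"

text \<open>A cycle is listed by its vertices, without repeating the first one at the end; the index
  modulo the length supplies the closing edge.\<close>

definition graph_cycle :: "'a set set \<Rightarrow> 'a list \<Rightarrow> bool" where
  "graph_cycle E vs \<longleftrightarrow> length vs \<ge> 3 \<and> distinct vs \<and>
     (\<forall>i<length vs. {vs ! i, vs ! (Suc i mod length vs)} \<in> E)"

definition graph_acyclic :: "'a set set \<Rightarrow> bool" where
  "graph_acyclic E \<longleftrightarrow> (\<nexists>vs. graph_cycle E vs)"

definition spanning_forests :: "'a set set \<Rightarrow> 'a set set set" where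
  "spanning_forests E = {A. A \<subseteq> E \<and> graph_acyclic A}"

definition spanning_trees :: "'a set \<Rightarrow> 'a set set \<Rightarrow> 'a set set set" where
  "spanning_trees V E = {A. A \<subseteq> E \<and> graph_connected V A \<and> graph_acyclic A}"

definition num_forests :: "'a set set \<Rightarrow> nat" where
  "num_forests E = card (spanning_forests E)"

definition num_trees :: "'a set \<Rightarrow> 'a set set \<Rightarrow> nat" where
  "num_trees V E = card (spanning_trees V E)"

definition forest_tree_ratio :: "'a set \<Rightarrow> 'a set set \<Rightarrow> real" where
  "forest_tree_ratio V E = real (num_forests E) / real (num_trees V E)"

end

theory Submission
  imports Defs "HOL-Analysis.Convex"
begin

text \<open>Fix a vertex \<open>r\<close>. For a connected graph on \<open>S\<close> with \<open>T\<close> spanning trees let \<open>g\<close> be the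
  inverse of the Laplacian with the row and column of \<open>r\<close> deleted. The component avoiding \<open>r\<close>
  of a spanning forest with two components is a tree, and counting its vertices minus its edges
  gives that the number \<open>F\<^sub>2\<close> of these forests satisfies
  \<open>F\<^sub>2/T = \<Sum>\<^sub>x g(x,x) - \<Sum>\<^sub>x\<^sub>y (g(x,x) g(y,y) - g(x,y)\<^sup>2)\<close>, the second sum over the edges avoiding \<open>r\<close>.
  As \<open>d(x) g(x,x) = 1 + \<Sum>\<^sub>y\<^sub>~\<^sub>x g(x,y)\<close>, the inequalities \<open>2ab \<le> a\<^sup>2 + b\<^sup>2\<close> and Cauchy-Schwarz
  turn this into \<open>F\<^sub>2/T \<ge> \<Sum>\<^sub>x 1/(2d(x)) + \<Sum>\<^sub>x\<^sub>~\<^sub>r g(x,x)\<^sup>2/2 \<ge> 1/2 + 1/(2d(r))\<close>.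

  Now let \<open>f(t)\<close> be the sum of \<open>t\<^sup>c\<^sup>-\<^sup>1\<close> over all spanning forests, \<open>c\<close> being the number of
  components. Its derivative marks a second component besides that of \<open>r\<close>; applying the bound on
  \<open>F\<^sub>2\<close> to the subgraph spanned by these two components gives \<open>f'(t) > f(t)/2\<close> for \<open>0 < t < 1\<close>. The
  forests in which \<open>r\<close> is isolated are not covered by the bound; the term \<open>1/(2d(r))\<close> pays for
  them, since each of them extends in \<open>d(r)\<close> ways to a forest in which \<open>r\<close> is a leaf.
  Hence \<open>f(1) > exp(1/2) f(0)\<close>, where \<open>f(0)\<close> counts trees and \<open>f(1)\<close> forests.\<close>

section \<open>Connectivity and cycles\<close>

definition conn :: "'a set set \<Rightarrow> 'a \<Rightarrow> 'a \<Rightarrow> bool" where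
  "conn A x y \<longleftrightarrow> (x, y) \<in> {(x, y). {x, y} \<in> A}\<^sup>*"

lemma conn_refl [simp, intro]: "conn A x x"
  by (simp add: conn_def)

lemma conn_edge: "{x, y} \<in> A \<Longrightarrow> conn A x y"
  by (auto simp: conn_def)

lemma conn_trans [trans]: "conn A x y \<Longrightarrow> conn A y z \<Longrightarrow> conn A x z"
  by (auto simp: conn_def)

lemma conn_sym: "conn A x y \<Longrightarrow> conn A y x"
  unfolding conn_def
  by (rule symD[OF sym_rtrancl]) (auto simp: sym_def insert_commute)

lemma conn_commute: "conn A x y \<longleftrightarrow> conn A y x"
  by (blast intro: conn_sym)

lemma conn_mono: "conn A x y \<Longrightarrow> A \<subseteq> B \<Longrightarrow> conn B x y"
  unfolding conn_def by (rule rtrancl_mono[THEN subsetD, rotated]) auto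

lemma conn_induct [consumes 1, case_names refl step]:
  assumes "conn A x y" "P x" "\<And>y z. conn A x y \<Longrightarrow> {y, z} \<in> A \<Longrightarrow> P y \<Longrightarrow> P z"
  shows "P y"
  using assms(1) unfolding conn_def
  by (induction rule: rtrancl_induct) (use assms(2,3) in \<open>auto simp: conn_def\<close>)

text \<open>A walk can be shortened until it uses the new edge at most once, in one of its two
  directions.\<close>

lemma conn_insert:
  "conn (insert {x, y} A) a b \<longleftrightarrow>
     conn A a b \<or> conn A a x \<and> conn A y b \<or> conn A a y \<and> conn A x b" (is "?l \<longleftrightarrow> ?r b")
proof
  assume ?l
  then show "?r b"
  proof (induction rule: conn_induct)
    case (step y' z)
    show ?case
    proof (cases "{y', z} \<in> A")
      case True
      with step.IH show ?thesis by (meson conn_edge conn_trans)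
    next
      case False
      with step(2) have "y' = x \<and> z = y \<or> y' = y \<and> z = x"
        by (auto simp: doubleton_eq_iff)
      with step.IH show ?thesis by auto
    qed
  qed auto
next
  have "conn (insert {x, y} A) x y" by (simp add: conn_edge)
  moreover assume "?r b"
  ultimately show ?l by (meson conn_mono conn_trans conn_sym subset_insertI)
qed

text \<open>After its last visit to \<open>x\<close>, a walk to \<open>r\<close> uses no edge at
  \<open>x\<close>. The induction follows the walk from \<open>r\<close>: once it has touched
  \<open>x\<close>, the second disjunct stays true.\<close>

lemma conn_first_edge:
  assumes "conn B x r" "x \<noteq> r"
  shows "\<exists>z. {x, z} \<in> B \<and> conn {e \<in> B. x \<notin> e} z r"
proof -
  let ?B = "{e \<in> B. x \<notin> e}"
  have "(y \<noteq> x \<and> conn ?B y r) \<or> (\<exists>z. {x, z} \<in> B \<and> conn ?B z r)" if "conn B r y" for y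
    using that
  proof (induction rule: conn_induct)
    case (step y z)
    show ?case
    proof (cases "y = x \<or> z = x")
      case True
      with step show ?thesis by (auto simp: insert_commute)
    next
      case False
      then have "conn ?B z y"
        using step(2) by (intro conn_edge) (auto simp: insert_commute)
      with False step.IH show ?thesis by (auto intro: conn_trans)
    qed
  qed (use assms in auto)
  from this[OF conn_sym[OF assms(1)]] show ?thesis by auto
qed

text \<open>Passes to vertex lists as in \<open>graph_cycle\<close>: when the walk returns to a
  listed vertex, the list is cut there and stays distinct.\<close>

lemma conn_path:
  assumes "conn A x y"
  shows "\<exists>vs. vs \<noteq> [] \<and> distinct vs \<and> hd vs = x \<and> last vs = y \<and>
     (\<forall>i. Suc i < length vs \<longrightarrow> {vs ! i, vs ! Suc i} \<in> A)"
  using assms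
proof (induction rule: conn_induct)
  case refl
  show ?case by (rule exI[of _ "[x]"]) auto
next
  case (step y z)
  then obtain vs where vs: "vs \<noteq> []" "distinct vs" "hd vs = x" "last vs = y"
    "\<And>i. Suc i < length vs \<Longrightarrow> {vs ! i, vs ! Suc i} \<in> A" by blast
  show ?case
  proof (cases "z \<in> set vs")
    case True
    then obtain i where i: "i < length vs" "vs ! i = z" by (auto simp: in_set_conv_nth)
    have "last (take (Suc i) vs) = z" using i by (simp add: take_Suc_conv_app_nth)
    then show ?thesis
      by (intro exI[of _ "take (Suc i) vs"]) (use vs i in auto)
  next
    case False
    have "{(vs @ [z]) ! i, (vs @ [z]) ! Suc i} \<in> A" if "Suc i < length (vs @ [z])" for i
    proof (cases "Suc i < length vs")
      case True
      with vs(5) show ?thesis by (simp add: nth_append)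
    next
      case False
      with that have "i = length vs - 1" "Suc i = length vs" by auto
      moreover have "vs ! (length vs - 1) = y" using vs by (simp add: last_conv_nth)
      ultimately show ?thesis using step(2) vs(1) by (simp add: nth_append)
    qed
    then show ?thesis by (intro exI[of _ "vs @ [z]"]) (use vs False in auto)
  qed
qed

section \<open>Acyclicity: every edge is a bridge\<close>

lemma graph_acyclic_mono: "graph_acyclic B \<Longrightarrow> A \<subseteq> B \<Longrightarrow> graph_acyclic A"
  unfolding graph_acyclic_def graph_cycle_def by blast

lemma graph_acyclic_empty [simp]: "graph_acyclic {}"
  unfolding graph_acyclic_def graph_cycle_def by (auto intro!: exI[of _ 0])

text \<open>A path that joins the ends of the edge without using it is closed to a cycle by the
  edge. Together with \<open>acyclic_if_bridges\<close> this allows later arguments to use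
  \<open>conn\<close> instead of vertex lists.\<close>

lemma bridge_if_acyclic:
  assumes "graph_acyclic A" "{x, y} \<in> A" "x \<noteq> y"
  shows "\<not> conn (A - {{x, y}}) x y"
proof
  assume "conn (A - {{x, y}}) x y"
  then obtain vs where vs: "vs \<noteq> []" "distinct vs" "hd vs = x" "last vs = y"
    "\<And>i. Suc i < length vs \<Longrightarrow> {vs ! i, vs ! Suc i} \<in> A - {{x, y}}"
    using conn_path by metis
  \<comment> \<open>Length 1 would mean \<open>x = y\<close>, and length 2 that the path is the
    removed edge itself.\<close>
  have "length vs \<noteq> 1" using vs assms(3) by (metis last_conv_nth hd_conv_nth diff_self_eq_0)
  moreover have "length vs \<noteq> 2"
  proof
    assume "length vs = 2"
    with vs show False using vs(5)[of 0] by (auto simp: hd_conv_nth last_conv_nth)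
  qed
  moreover have "length vs \<noteq> 0" using vs by simp
  ultimately have len: "length vs \<ge> 3" by linarith
  have "{vs ! i, vs ! (Suc i mod length vs)} \<in> A" if "i < length vs" for i
  proof (cases "Suc i < length vs")
    case True
    with vs(5)[OF True] show ?thesis by simp
  next
    case False
    with that have "Suc i = length vs" by simp
    with vs assms(2) show ?thesis
      by (metis diff_Suc_1 hd_conv_nth insert_commute last_conv_nth mod_self)
  qed
  with len vs(2) have "graph_cycle A vs" by (simp add: graph_cycle_def)
  with assms(1) show False by (auto simp: graph_acyclic_def)
qed

lemma acyclic_if_bridges:
  assumes "\<And>x y. {x, y} \<in> A \<Longrightarrow> x \<noteq> y \<Longrightarrow> \<not> conn (A - {{x, y}}) x y"
  shows "graph_acyclic A"
  unfolding graph_acyclic_def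
proof
  assume "\<exists>vs. graph_cycle A vs"
  then obtain vs where len: "length vs \<ge> 3" and dist: "distinct vs"
    and cyc: "\<And>i. i < length vs \<Longrightarrow> {vs ! i, vs ! (Suc i mod length vs)} \<in> A"
    by (auto simp: graph_cycle_def)
  define n where "n = length vs"
  define x y where "x = vs ! 0" and "y = vs ! (n - 1)"
  have xy: "x \<noteq> y"
    unfolding x_def y_def n_def by (subst nth_eq_iff_index_eq[OF dist]) (use len in auto)
  have "Suc (n - 1) = n" using len unfolding n_def by linarith
  then have "Suc (n - 1) mod n = 0" "n - 1 < n" by simp_all
  with cyc[of "n - 1"] have "{x, y} \<in> A"
    unfolding x_def y_def by (metis n_def insert_commute)
  \<comment> \<open>The cycle is followed from \<open>x\<close> to \<open>y\<close> the long way;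
    with at least three distinct vertices no edge on that way equals the closing edge.\<close>
  have "conn (A - {{x, y}}) x (vs ! i)" if "i < n" for i
    using that
  proof (induction i)
    case (Suc i)
    have "{vs ! i, vs ! Suc i} \<in> A" using cyc[of i] Suc.prems by (simp add: n_def)
    moreover have "{vs ! i, vs ! Suc i} \<noteq> {x, y}"
    proof
      assume "{vs ! i, vs ! Suc i} = {x, y}"
      then have "vs ! i = vs ! 0 \<and> vs ! Suc i = vs ! (n - 1) \<or>
          vs ! i = vs ! (n - 1) \<and> vs ! Suc i = vs ! 0"
        by (auto simp: doubleton_eq_iff x_def y_def)
      then have "i = 0 \<and> Suc i = n - 1 \<or> i = n - 1 \<and> Suc i = 0"
        using nth_eq_iff_index_eq[OF dist, of i 0] nth_eq_iff_index_eq[OF dist, of i "n - 1"]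
          nth_eq_iff_index_eq[OF dist, of "Suc i" 0] nth_eq_iff_index_eq[OF dist, of "Suc i" "n - 1"]
          Suc.prems len unfolding n_def by linarith
      then show False using len Suc.prems unfolding n_def by linarith
    qed
    ultimately have "conn (A - {{x, y}}) (vs ! i) (vs ! Suc i)" by (intro conn_edge) auto
    with Suc show ?case by (meson Suc_lessD conn_trans)
  qed (auto simp: x_def)
  from this[of "n - 1"] have "conn (A - {{x, y}}) x y" using len by (simp add: y_def n_def)
  with assms[OF \<open>{x, y} \<in> A\<close> xy] show False by blast
qed

text \<open>A cycle through the new edge would leave a walk from \<open>x\<close> to
  \<open>y\<close> in \<open>A\<close>.\<close>

lemma acyclic_insert:
  assumes "graph_acyclic A" "\<not> conn A x y"
  shows "graph_acyclic (insert {x, y} A)"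
proof (rule acyclic_if_bridges)
  fix a b assume ab: "{a, b} \<in> insert {x, y} A" "a \<noteq> b"
  show "\<not> conn (insert {x, y} A - {{a, b}}) a b"
  proof (cases "{a, b} = {x, y}")
    case True
    then have "a = x \<and> b = y \<or> a = y \<and> b = x" by (auto simp: doubleton_eq_iff)
    then have "\<not> conn A a b" using assms(2) conn_sym by metis
    moreover have "insert {x, y} A - {{a, b}} \<subseteq> A" using True by auto
    ultimately show ?thesis using conn_mono by metis
  next
    case False
    with ab have "{a, b} \<in> A" by auto
    have eq: "insert {x, y} A - {{a, b}} = insert {x, y} (A - {{a, b}})" using False by auto
    have n: "\<not> conn (A - {{a, b}}) a b" using bridge_if_acyclic assms(1) \<open>{a, b} \<in> A\<close> ab(2) by metis
    have m: "conn (A - {{a, b}}) u v \<Longrightarrow> conn A u v" for u v by (rule conn_mono) auto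
    have e: "conn A a b" using \<open>{a, b} \<in> A\<close> by (rule conn_edge)
    show ?thesis unfolding eq conn_insert using n m e assms(2) by (meson conn_sym conn_trans)
  qed
qed

lemma conn_Un_disjoint:
  assumes "\<Union>A \<subseteq> H" "\<Union>B \<subseteq> K" "H \<inter> K = {}" "x \<in> H"
  shows "conn (A \<union> B) x y \<longleftrightarrow> conn A x y"
proof
  assume "conn (A \<union> B) x y"
  then have "conn A x y \<and> y \<in> H"
  proof (induction rule: conn_induct)
    case (step y z)
    then have "{y, z} \<in> A" using assms by auto
    with step assms(1) show ?case by (auto intro: conn_trans conn_edge)
  qed (use assms in auto)
  then show "conn A x y" ..
qed (auto intro: conn_mono)

lemma conn_closed: "conn A x y \<Longrightarrow> \<Union>A \<subseteq> S \<Longrightarrow> x \<in> S \<Longrightarrow> y \<in> S"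
  by (induction rule: conn_induct) auto

lemma acyclic_Un_disjoint:
  assumes "\<Union>A \<subseteq> H" "\<Union>B \<subseteq> K" "H \<inter> K = {}" "graph_acyclic A" "graph_acyclic B"
  shows "graph_acyclic (A \<union> B)"
proof (rule acyclic_if_bridges)
  fix x y assume xy: "{x, y} \<in> A \<union> B" "x \<noteq> y"
  have *: "\<not> conn ((A' \<union> B') - {{x, y}}) x y"
    if "{x, y} \<in> A'" "\<Union>A' \<subseteq> H'" "\<Union>B' \<subseteq> K'" "H' \<inter> K' = {}" "graph_acyclic A'" for A' B' H' K'
  proof -
    have "{x, y} \<notin> B'" using that by auto
    then have "(A' \<union> B') - {{x, y}} = (A' - {{x, y}}) \<union> B'" by auto
    moreover have "conn ((A' - {{x, y}}) \<union> B') x y \<longleftrightarrow> conn (A' - {{x, y}}) x y"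
      by (rule conn_Un_disjoint[where H = H' and K = K']) (use that in auto)
    ultimately show ?thesis using bridge_if_acyclic that xy(2) by metis
  qed
  from xy(1) show "\<not> conn (A \<union> B - {{x, y}}) x y"
  proof
    assume "{x, y} \<in> A"
    with * assms show ?thesis by blast
  next
    assume "{x, y} \<in> B"
    with *[of B K A H] assms show ?thesis by (simp add: Un_commute Int_commute)
  qed
qed

section \<open>Rooted forests and the Green function\<close>

lemma sum_Collect_of_bool:
  fixes f :: "'b \<Rightarrow> real"
  assumes "finite N"
  shows "(\<Sum>w\<in>{w \<in> N. P w}. f w) = (\<Sum>w\<in>N. of_bool (P w) * f w)"
  by (rule sum.mono_neutral_cong_left) (use assms in auto)

text \<open>Only the edges are fixed. Vertex sets are arguments, since later sums range over the
  vertex sets of components and of their unions.\<close>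

locale edge_set =
  fixes E :: "'a set set"
  assumes edge_card: "e \<in> E \<Longrightarrow> card e = 2"
begin

definition forests :: "'a set \<Rightarrow> 'a set set set" where
  "forests S = {A. A \<subseteq> E \<and> \<Union>A \<subseteq> S \<and> graph_acyclic A}"

text \<open>For \<open>R\<close> inside a finite \<open>S\<close>, the number of these forests is,
  by the matrix-tree theorem, the determinant of the Laplacian on \<open>S\<close> with the rows and
  columns of \<open>R\<close> deleted.\<close>

definition rooted :: "'a set \<Rightarrow> 'a set \<Rightarrow> 'a set set set" where
  "rooted S R = {A \<in> forests S. \<forall>v\<in>S. \<exists>!\<rho>. \<rho> \<in> R \<and> conn A v \<rho>}"

definition nb :: "'a set \<Rightarrow> 'a \<Rightarrow> 'a set" where
  "nb S x = {y \<in> S. {x, y} \<in> E}"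

lemma edge_neq: "{x, y} \<in> E \<Longrightarrow> x \<noteq> y"
  using edge_card[of "{x, y}"] by auto

lemma nb_not_self: "y \<in> nb S x \<Longrightarrow> y \<noteq> x"
  using edge_neq by (auto simp: nb_def)

lemma finite_nb [simp]: "finite S \<Longrightarrow> finite (nb S x)"
  by (simp add: nb_def)

lemma finite_forests [simp]: "finite S \<Longrightarrow> finite (forests S)"
  by (rule finite_subset[of _ "Pow (Pow S)"]) (auto simp: forests_def)

lemma finite_rooted [simp]: "finite S \<Longrightarrow> finite (rooted S R)"
  by (rule finite_subset[of _ "forests S"]) (auto simp: rooted_def)

lemma finite_forest: "finite S \<Longrightarrow> A \<in> forests S \<Longrightarrow> finite A"
  by (rule finite_subset[of _ "Pow S"]) (auto simp: forests_def)

lemma rooted_forest: "A \<in> rooted S R \<Longrightarrow> A \<in> forests S"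
  by (simp add: rooted_def)

lemma rooted_root: "A \<in> rooted S R \<Longrightarrow> v \<in> S \<Longrightarrow> \<exists>\<rho>\<in>R. conn A v \<rho>"
  by (auto simp: rooted_def)

lemma rooted_unique:
  "A \<in> rooted S R \<Longrightarrow> v \<in> S \<Longrightarrow> conn A v a \<Longrightarrow> conn A v b \<Longrightarrow> a \<in> R \<Longrightarrow> b \<in> R \<Longrightarrow> a = b"
  by (auto simp: rooted_def)

lemma rooted_roots_apart:
  "A \<in> rooted S R \<Longrightarrow> R \<subseteq> S \<Longrightarrow> conn A a b \<Longrightarrow> a \<in> R \<Longrightarrow> b \<in> R \<Longrightarrow> a = b"
  using rooted_unique[of A S R a a b] by auto

section \<open>Trading a root for an edge\<close>

lemma rootedI:
  assumes "A \<in> forests S" "\<And>v. v \<in> S \<Longrightarrow> \<exists>\<rho>\<in>R. conn A v \<rho>"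
    "\<And>v a b. v \<in> S \<Longrightarrow> conn A v a \<Longrightarrow> conn A v b \<Longrightarrow> a \<in> R \<Longrightarrow> b \<in> R \<Longrightarrow> a = b"
  shows "A \<in> rooted S R"
  using assms unfolding rooted_def by blast

lemma forest_bridge:
  assumes "A \<in> forests S" "{x, y} \<in> A"
  shows "\<not> conn (A - {{x, y}}) x y"
proof (rule bridge_if_acyclic[OF _ assms(2)])
  show "graph_acyclic A" "x \<noteq> y" using assms edge_neq[of x y] by (auto simp: forests_def)
qed

text \<open>\<open>z\<close> lies in the component of another root, which becomes the root of the
  joined component.\<close>

lemma rooted_add_edge:
  assumes A: "A \<in> rooted S (insert x R)" and x: "x \<in> S" "x \<notin> R" and R: "R \<subseteq> S"
    and z: "z \<in> nb S x" "\<not> conn A x z"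
  shows "insert {x, z} A \<in> rooted S R"
proof (rule rootedI)
  have zS: "z \<in> S" and xz: "{x, z} \<in> E" using z by (auto simp: nb_def)
  have xx: "\<not> conn A x b" if "b \<in> R" for b
    using rooted_unique[OF A x(1), of x b] that x(2) by auto
  have sym: "conn A a b \<Longrightarrow> conn A b a" for a b by (rule conn_sym)
  have tr: "conn A a b \<Longrightarrow> conn A b c \<Longrightarrow> conn A a c" for a b c by (rule conn_trans)
  obtain w where w: "w \<in> R" "conn A z w"
    using rooted_root[OF A zS] z(2) sym by auto
  show "insert {x, z} A \<in> forests S"
    using rooted_forest[OF A] xz x zS acyclic_insert[OF _ z(2)] by (auto simp: forests_def)
  show "\<exists>\<rho>\<in>R. conn (insert {x, z} A) v \<rho>" if "v \<in> S" for v
    using rooted_root[OF A that] w unfolding conn_insert by blast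
  show "a = b" if "v \<in> S" "conn (insert {x, z} A) v a" "conn (insert {x, z} A) v b" "a \<in> R" "b \<in> R"
    for v a b
  proof -
    have a: "conn A v a \<or> conn A v x \<and> conn A z a" using that xx unfolding conn_insert by blast
    have b: "conn A v b \<or> conn A v x \<and> conn A z b" using that xx unfolding conn_insert by blast
    have "conn A v a \<and> conn A v b \<or> conn A z a \<and> conn A z b"
      using a b xx sym tr that(4,5) by blast
    then show ?thesis using rooted_unique[OF A] that zS by blast
  qed
qed

text \<open>\<open>z\<close> follows \<open>x\<close> on the path in \<open>B\<close> from
  \<open>x\<close> to its root. The edge between them is a bridge, so without it \<open>x\<close> is
  cut off from all of \<open>R\<close>.\<close>

lemma rooted_remove_edge:
  assumes B: "B \<in> rooted S R" and x: "x \<in> S" "x \<notin> R" and R: "R \<subseteq> S"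
  shows "\<exists>A z. A \<in> rooted S (insert x R) \<and> z \<in> nb S x \<and> \<not> conn A x z \<and> B = insert {x, z} A"
proof -
  obtain \<rho> where \<rho>: "\<rho> \<in> R" "conn B x \<rho>" using rooted_root[OF B x(1)] by blast
  with x obtain z where z: "{x, z} \<in> B" "conn {e \<in> B. x \<notin> e} z \<rho>"
    using conn_first_edge by metis
  define A where "A = B - {{x, z}}"
  have BA: "B = insert {x, z} A" using z by (auto simp: A_def)
  have zr: "conn A z \<rho>" using z(2) by (rule conn_mono) (auto simp: A_def)
  have Bf: "B \<in> forests S" using B by (rule rooted_forest)
  have nxz: "\<not> conn A x z" unfolding A_def using forest_bridge[OF Bf z(1)] .
  have znb: "z \<in> nb S x" using z(1) Bf by (auto simp: forests_def nb_def)
  have mono: "conn A u v \<Longrightarrow> conn B u v" for u v by (rule conn_mono) (auto simp: BA)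
  have sym: "conn A a b \<Longrightarrow> conn A b a" for a b by (rule conn_sym)
  have tr: "conn A a b \<Longrightarrow> conn A b c \<Longrightarrow> conn A a c" for a b c by (rule conn_trans)
  have xx: "\<not> conn A x b" if "b \<in> R" for b
  proof
    assume "conn A x b"
    then have "b = \<rho>" using mono rooted_unique[OF B x(1)] that \<rho> by blast
    then show False using \<open>conn A x b\<close> nxz zr sym tr by blast
  qed
  have "A \<in> rooted S (insert x R)"
  proof (rule rootedI)
    show "A \<in> forests S"
      using Bf graph_acyclic_mono[of B A] by (auto simp: forests_def A_def)
    show "\<exists>\<rho>\<in>insert x R. conn A v \<rho>" if v: "v \<in> S" for v
      using rooted_root[OF B v] zr \<rho>(1) tr unfolding BA conn_insert by blast
    show "a = b" if "v \<in> S" "conn A v a" "conn A v b" "a \<in> insert x R" "b \<in> insert x R" for v a b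
      using that xx sym tr mono rooted_unique[OF B that(1)] by (metis insertE)
  qed
  with znb nxz BA show ?thesis by blast
qed

text \<open>A rooted forest in which \<open>x\<close> is not a root is a rooted forest with the additional
  root \<open>x\<close> together with the first edge on the path from \<open>x\<close> to its root.\<close>

lemma rooted_first_edge_bij:
  assumes x: "x \<in> S" "x \<notin> R" and R: "R \<subseteq> S"
  shows "bij_betw (\<lambda>(A, z). insert {x, z} A)
    (SIGMA A:rooted S (insert x R). {z \<in> nb S x. \<not> conn A x z}) (rooted S R)"
proof (rule bij_betwI')
  fix p q
  assume "p \<in> (SIGMA A:rooted S (insert x R). {z \<in> nb S x. \<not> conn A x z})"
    "q \<in> (SIGMA A:rooted S (insert x R). {z \<in> nb S x. \<not> conn A x z})"
  then obtain A z A' z' where p: "p = (A, z)" and q: "q = (A', z')"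
    and A: "A \<in> rooted S (insert x R)" "z \<in> nb S x" "\<not> conn A x z"
    and A': "A' \<in> rooted S (insert x R)" "z' \<in> nb S x" "\<not> conn A' x z'"
    by auto
  have notin: "{x, z} \<notin> A" "{x, z'} \<notin> A'" using A(3) A'(3) conn_edge by metis+
  have "A = A' \<and> z = z'" if eq: "insert {x, z} A = insert {x, z'} A'"
  proof (cases "z = z'")
    case True
    with eq notin show ?thesis by (metis Diff_insert_absorb)
  next
    case False
    then have neq: "{x, z} \<noteq> {x, z'}" by (auto simp: doubleton_eq_iff)
    define C where "C = A - {{x, z'}}"
    have z'A: "{x, z'} \<in> A" using eq neq by (metis insertE insertI1)
    have A'C: "A' = insert {x, z} C"
      using eq notin neq unfolding C_def by (metis Diff_insert_absorb insert_Diff_if singletonD)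
    have CA: "conn C u v \<Longrightarrow> conn A u v" for u v by (rule conn_mono) (auto simp: C_def)
    have CA': "conn C u v \<Longrightarrow> conn A' u v" for u v by (rule conn_mono) (auto simp: A'C)
    have z'S: "z' \<in> S" using A'(2) by (simp add: nb_def)
    \<comment> \<open>In \<open>A\<close> the vertex \<open>z'\<close> belongs to the root
      \<open>x\<close>, so a walk from \<open>z'\<close> to \<open>\<rho>\<close> in
      \<open>A'\<close> needs the edge \<open>{x, z}\<close>. Then \<open>C\<close> links
      \<open>x\<close> with \<open>z'\<close> or with \<open>\<rho>\<close>, and neither is
      possible.\<close>
    obtain \<rho> where \<rho>: "\<rho> \<in> R" "conn A' z' \<rho>"
      using rooted_root[OF A'(1) z'S] A'(3) conn_sym by (metis insertE)
    have nx: "\<not> conn A x \<rho>" using rooted_unique[OF A(1) x(1), of x \<rho>] x(2) \<rho>(1) by auto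
    then have "\<not> conn A z' \<rho>" using z'A by (meson conn_edge conn_trans)
    moreover have "\<not> conn C z' x" using CA' A'(3) conn_sym by metis
    ultimately show ?thesis using \<rho>(2) nx CA unfolding A'C conn_insert by blast
  qed
  then show "((case p of (A, z) \<Rightarrow> insert {x, z} A) = (case q of (A, z) \<Rightarrow> insert {x, z} A)) = (p = q)"
    by (auto simp: p q)
next
  fix p assume "p \<in> (SIGMA A:rooted S (insert x R). {z \<in> nb S x. \<not> conn A x z})"
  then show "(case p of (A, z) \<Rightarrow> insert {x, z} A) \<in> rooted S R"
    using rooted_add_edge x R by auto
next
  fix B assume "B \<in> rooted S R"
  then show "\<exists>p\<in>SIGMA A:rooted S (insert x R). {z \<in> nb S x. \<not> conn A x z}.
      B = (case p of (A, z) \<Rightarrow> insert {x, z} A)"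
    using rooted_remove_edge[OF _ x R] by fastforce
qed

lemma sum_rooted_first_edge:
  assumes "x \<in> S" "x \<notin> R" "R \<subseteq> S" "finite S"
  shows "(\<Sum>A\<in>rooted S R. f A) =
    (\<Sum>A\<in>rooted S (insert x R). \<Sum>z\<in>{z \<in> nb S x. \<not> conn A x z}. f (insert {x, z} A))"
proof -
  have "(\<Sum>A\<in>rooted S R. f A) =
      (\<Sum>p\<in>(SIGMA A:rooted S (insert x R). {z \<in> nb S x. \<not> conn A x z}). f (case p of (A, z) \<Rightarrow> insert {x, z} A))"
    by (rule sum.reindex_bij_betw[OF rooted_first_edge_bij[OF assms(1-3)], symmetric])
  also have "\<dots> = (\<Sum>A\<in>rooted S (insert x R). \<Sum>z\<in>{z \<in> nb S x. \<not> conn A x z}. f (insert {x, z} A))"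
    by (subst sum.Sigma) (use assms in \<open>auto intro!: sum.cong\<close>)
  finally show ?thesis .
qed

text \<open>Making one more vertex a root removes exactly one edge; when all vertices are roots, no
  edge is left.\<close>

lemma card_rooted_forest:
  assumes "finite S" "R \<subseteq> S" "A \<in> rooted S R"
  shows "card A + card R = card S"
  using assms(2,3)
proof (induction "card S - card R" arbitrary: R A)
  case 0
  then have "R = S" using assms(1) by (metis card_seteq diff_is_0_eq)
  have "A = {}"
  proof (rule ccontr)
    assume "A \<noteq> {}"
    then obtain e where e: "e \<in> A" by blast
    then have "e \<in> E" "e \<subseteq> S" using rooted_forest[OF 0(3)] by (auto simp: forests_def)
    then obtain x y where "e = {x, y}" "x \<noteq> y" using edge_card by (meson card_2_iff)
    with e \<open>e \<subseteq> S\<close> have "conn A x y" "x \<in> S" "y \<in> S" by (auto intro: conn_edge)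
    with rooted_roots_apart[OF 0(3)] \<open>R = S\<close> \<open>x \<noteq> y\<close> show False by blast
  qed
  with \<open>R = S\<close> show ?case by simp
next
  case (Suc n)
  then have "R \<noteq> S" by auto
  with Suc.prems obtain x where x: "x \<in> S" "x \<notin> R" by blast
  have fR: "finite R" using Suc.prems assms(1) finite_subset by blast
  obtain A' z where A': "A' \<in> rooted S (insert x R)" "\<not> conn A' x z" "A = insert {x, z} A'"
    using rooted_remove_edge[OF Suc.prems(2) x Suc.prems(1)] by blast
  have "{x, z} \<notin> A'" using A'(2) conn_edge by metis
  moreover have "finite A'" using finite_forest[OF assms(1)] A'(1) rooted_forest by blast
  moreover have "card A' + card (insert x R) = card S"
    by (rule Suc.hyps(1)) (use Suc x fR A' in auto)
  ultimately show ?case using A'(3) x fR by simp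
qed

text \<open>Divided by \<open>card (rooted S R)\<close>, this is the Green function of the walk killed at \<open>R\<close>.\<close>

definition linked :: "'a set \<Rightarrow> 'a set \<Rightarrow> 'a \<Rightarrow> 'a \<Rightarrow> real" where
  "linked S R x y = real (card {A \<in> rooted S (insert y R). conn A x y})"

text \<open>The boundary condition: the Green function vanishes on \<open>R\<close>.\<close>

lemma linked_root:
  assumes "R \<subseteq> S" "x \<in> R" "y \<in> S" "y \<notin> R"
  shows "linked S R x y = 0"
proof -
  have "{A \<in> rooted S (insert y R). conn A x y} = {}"
    using rooted_roots_apart[of _ S "insert y R" x y] assms by auto
  then show ?thesis by (simp only: linked_def card.empty of_nat_0)
qed

lemma linked_self: "linked S R x x = card (rooted S (insert x R))"
  by (simp add: linked_def)

lemma linked_sum: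
  assumes "finite S"
  shows "linked S R x y = (\<Sum>A\<in>rooted S (insert y R). of_bool (conn A x y))"
  using assms by (simp add: linked_def sum.If_cases of_bool_def Int_def)

text \<open>The left side counts pairs of a forest and a neighbour \<open>z\<close> of the root
  \<open>y\<close>. Pairs with \<open>z\<close> in the component of \<open>y\<close> give the sum;
  the others correspond to \<open>rooted S R\<close> by the first-edge bijection.\<close>

lemma linked_laplace_self:
  assumes "finite S" "R \<subseteq> S" "y \<in> S" "y \<notin> R"
  shows "card (nb S y) * linked S R y y = card (rooted S R) + (\<Sum>z\<in>nb S y. linked S R z y)"
proof -
  have "real (card (rooted S R)) =
      (\<Sum>A\<in>rooted S (insert y R). \<Sum>z\<in>{z \<in> nb S y. \<not> conn A y z}. 1)"
    using sum_rooted_first_edge[OF assms(3,4,2,1), of "\<lambda>_. 1 :: real"] by simp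
  also have "\<dots> = (\<Sum>A\<in>rooted S (insert y R). \<Sum>z\<in>nb S y. of_bool (\<not> conn A z y))"
    unfolding sum_Collect_of_bool[OF finite_nb[OF assms(1)]] by (simp add: conn_commute[of _ y])
  finally have "real (card (rooted S R)) + (\<Sum>z\<in>nb S y. linked S R z y) =
     (\<Sum>A\<in>rooted S (insert y R). \<Sum>z\<in>nb S y. of_bool (\<not> conn A z y) + of_bool (conn A z y))"
    by (simp add: linked_sum[OF assms(1)] sum.distrib sum.swap[of _ "nb S y"])
  also have "\<dots> = card (nb S y) * linked S R y y"
    by (simp add: linked_self of_bool_not_iff)
  finally show ?thesis by simp
qed

text \<open>Away from \<open>y\<close> the Green function is harmonic. Both sides are expanded with
  \<open>x\<close> as an additional root, \<open>w\<close> being the end of the first edge from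
  \<open>x\<close>; they then agree for each forest \<open>A\<close> separately.\<close>

lemma linked_laplace:
  assumes "finite S" "R \<subseteq> S" "y \<in> S" "y \<notin> R" "x \<in> S" "x \<notin> R" "x \<noteq> y"
  shows "card (nb S x) * linked S R x y = (\<Sum>z\<in>nb S x. linked S R z y)"
proof -
  let ?R = "insert y R"
  have R: "?R \<subseteq> S" and xR: "x \<notin> ?R" using assms by auto
  let ?N = "nb S x" and ?F = "rooted S (insert x ?R)"
  have fN: "finite ?N" using assms by simp
  note sum_eq = sum_Collect_of_bool[OF fN]
  have card_N: "(\<Sum>z\<in>?N. of_bool (P z)) + (\<Sum>z\<in>?N. of_bool (\<not> P z)) = real (card ?N)" for P
    by (simp add: of_bool_not_iff sum_subtractf)
  have *: "(\<Sum>z\<in>?N. \<Sum>w\<in>{w \<in> ?N. \<not> conn A x w}. of_bool (conn (insert {x, w} A) z y)) =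
      card ?N * (\<Sum>w\<in>{w \<in> ?N. \<not> conn A x w}. of_bool (conn (insert {x, w} A) x y) :: real)"
    if A: "A \<in> ?F" for A
  proof -
    have nxy: "\<not> conn A x y" using rooted_unique[OF A assms(5), of x y] assms by auto
    have apart: "\<not> conn A w y" if "conn A x w" for w
      using nxy that conn_trans by metis
    have eqx: "of_bool (\<not> conn A x w) * of_bool (conn (insert {x, w} A) x y) = (of_bool (conn A w y) :: real)" for w
      using apart[of w] by (auto simp: conn_insert nxy)
    have eqz: "of_bool (\<not> conn A x w) * of_bool (conn (insert {x, w} A) z y) =
       (of_bool (\<not> conn A x w) * of_bool (conn A z y) + of_bool (conn A x z) * of_bool (conn A w y) :: real)" for w z
      using apart[of w] apart[of z] by (auto simp: conn_insert nxy conn_commute[of A z x])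
    \<comment> \<open>With \<open>N\<close> neighbours of \<open>x\<close>, of which
      \<open>p\<close> are linked to \<open>x\<close> and \<open>q\<close> to \<open>y\<close> in
      \<open>A\<close>, the claim reads \<open>q * (N - p) + p * q = N * q\<close>.\<close>
    have "(\<Sum>z\<in>?N. \<Sum>w\<in>{w \<in> ?N. \<not> conn A x w}. of_bool (conn (insert {x, w} A) z y)) =
      (\<Sum>z\<in>?N. of_bool (conn A z y)) * (\<Sum>w\<in>?N. of_bool (\<not> conn A x w)) +
      (\<Sum>z\<in>?N. of_bool (conn A x z)) * (\<Sum>w\<in>?N. of_bool (conn A w y) :: real)"
      unfolding sum_eq eqz sum.distrib sum_product by (simp only: mult.commute)
    also have "\<dots> = real (card ?N) * (\<Sum>w\<in>?N. of_bool (conn A w y))"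
      unfolding card_N[of "conn A x", symmetric] by (simp only: ring_distribs add.commute mult.commute)
    finally show ?thesis unfolding sum_eq eqx .
  qed
  have "(\<Sum>z\<in>?N. linked S R z y) = (\<Sum>A\<in>?F. \<Sum>z\<in>?N. \<Sum>w\<in>{w \<in> ?N. \<not> conn A x w}. of_bool (conn (insert {x, w} A) z y))"
    unfolding linked_sum[OF assms(1)] sum_rooted_first_edge[OF assms(5) xR R assms(1)]
    by (rule sum.swap)
  also have "\<dots> = (\<Sum>A\<in>?F. real (card ?N) * (\<Sum>w\<in>{w \<in> ?N. \<not> conn A x w}. of_bool (conn (insert {x, w} A) x y)))"
    by (rule sum.cong[OF refl *])
  also have "\<dots> = card ?N * linked S R x y"
    unfolding linked_sum[OF assms(1)] sum_rooted_first_edge[OF assms(5) xR R assms(1)]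
    by (rule sum_distrib_left[symmetric])
  finally show ?thesis by simp
qed

section \<open>Decomposition into trees\<close>

text \<open>Excluding the empty vertex set makes \<open>T {} = 0\<close>, so that sums over all
  vertex subsets may include it.\<close>

definition trees :: "'a set \<Rightarrow> 'a set set set" where
  "trees S = {A \<in> forests S. S \<noteq> {} \<and> (\<forall>x\<in>S. \<forall>y\<in>S. conn A x y)}"

abbreviation T :: "'a set \<Rightarrow> real" where
  "T S \<equiv> real (card (trees S))"

lemma trees_empty [simp]: "trees {} = {}"
  by (simp add: trees_def)

lemma finite_trees [simp]: "finite S \<Longrightarrow> finite (trees S)"
  by (rule finite_subset[of _ "forests S"]) (auto simp: trees_def)

lemma trees_forests: "A \<in> trees S \<Longrightarrow> A \<in> forests S"
  by (simp add: trees_def)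

lemma trees_eq_rooted:
  assumes "r \<in> S"
  shows "trees S = rooted S {r}"
proof -
  have "(\<forall>x\<in>S. \<forall>y\<in>S. conn A x y) \<longleftrightarrow> (\<forall>v\<in>S. conn A v r)" for A
    using assms conn_sym conn_trans by metis
  then show ?thesis using assms by (auto simp: trees_def rooted_def)
qed

lemma card_tree:
  assumes "finite S" "A \<in> trees S"
  shows "card A + 1 = card S"
proof -
  obtain r where r: "r \<in> S" using assms by (auto simp: trees_def)
  with card_rooted_forest[of S "{r}" A] assms show ?thesis by (simp add: trees_eq_rooted)
qed

lemma forest_edge_cases:
  assumes "A \<in> forests S" "e \<in> A"
  obtains x y where "e = {x, y}" "x \<noteq> y" "x \<in> S" "y \<in> S"
proof -
  have "card e = 2" "e \<subseteq> S" using assms edge_card by (auto simp: forests_def)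
  then show ?thesis using that by (auto simp: card_2_iff)
qed

lemma forests_Un:
  assumes "A \<in> forests H" "B \<in> forests K" "H \<inter> K = {}"
  shows "A \<union> B \<in> forests (H \<union> K)"
  using assms acyclic_Un_disjoint[of A H B K] by (auto simp: forests_def)

lemma forests_Un_restrict:
  assumes "A \<in> forests H" "B \<in> forests K" "H \<inter> K = {}"
  shows "{e \<in> A \<union> B. e \<subseteq> H} = A"
proof -
  have "\<not> e \<subseteq> H" if "e \<in> B" for e
    using that assms(2,3) by (elim forest_edge_cases[OF assms(2)]) auto
  moreover have "e \<subseteq> H" if "e \<in> A" for e
    using that assms(1) by (auto simp: forests_def)
  ultimately show ?thesis by blast
qed

lemma forests_Un_conn:
  assumes "A \<in> forests H" "B \<in> forests K" "H \<inter> K = {}" "x \<in> H"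
  shows "conn (A \<union> B) x y \<longleftrightarrow> conn A x y"
  using conn_Un_disjoint[of A H B K x y] assms by (simp add: forests_def)

lemma trees_Un_component:
  assumes "A \<in> trees H" "B \<in> forests K" "H \<inter> K = {}" "x \<in> H"
  shows "{y. conn (A \<union> B) x y} = H"
proof -
  have A: "A \<in> forests H" using assms(1) by (rule trees_forests)
  have "conn (A \<union> B) x y \<longleftrightarrow> y \<in> H" for y
    unfolding forests_Un_conn[OF A assms(2-4)]
  proof
    show "conn A x y \<Longrightarrow> y \<in> H" using A assms(4) conn_closed[of A x y H] by (simp add: forests_def)
    show "y \<in> H \<Longrightarrow> conn A x y" using assms(1,4) by (simp add: trees_def)
  qed
  then show ?thesis by blast
qed

lemma forest_split:
  assumes A: "A \<in> forests S" and r: "r \<in> S" and H: "H = {y. conn A r y}"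
  shows "H \<subseteq> S" "{e \<in> A. e \<subseteq> H} \<in> trees H" "{e \<in> A. e \<subseteq> S - H} \<in> forests (S - H)"
    "A = {e \<in> A. e \<subseteq> H} \<union> {e \<in> A. e \<subseteq> S - H}"
proof -
  let ?A = "{e \<in> A. e \<subseteq> H}" and ?B = "{e \<in> A. e \<subseteq> S - H}"
  show HS: "H \<subseteq> S" using conn_closed[of A r _ S] A r by (auto simp: H forests_def)
  have "e \<subseteq> H \<or> e \<subseteq> S - H" if e: "e \<in> A" for e
  proof -
    obtain x y where "e = {x, y}" "x \<in> S" "y \<in> S" using forest_edge_cases[OF A e] by metis
    moreover have "conn A r x \<longleftrightarrow> conn A r y" using e \<open>e = {x, y}\<close>
      by (meson conn_edge conn_sym conn_trans)
    ultimately show ?thesis by (auto simp: H)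
  qed
  then show AU: "A = ?A \<union> ?B" by blast
  have fo: "?A \<in> forests H" "?B \<in> forests (S - H)"
    using A graph_acyclic_mono[of A ?A] graph_acyclic_mono[of A ?B] by (auto simp: forests_def)
  then show "?B \<in> forests (S - H)" by blast
  have "conn ?A x y" if "x \<in> H" "y \<in> H" for x y
  proof -
    have "conn A x y" using that by (auto simp: H intro: conn_sym conn_trans)
    then show ?thesis using forests_Un_conn[OF fo _ that(1)] AU by auto
  qed
  moreover have "r \<in> H" by (simp add: H)
  ultimately show "?A \<in> trees H" using fo(1) by (auto simp: trees_def)
qed

text \<open>No edge of a forest joins the component of \<open>r\<close> to the rest, so the tree on
  \<open>H\<close> and the forest on \<open>S - H\<close> determine the forest.\<close>

lemma forests_component_bij:
  assumes r: "r \<in> S"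
  shows "bij_betw (\<lambda>(H, A, B). A \<union> B)
    (SIGMA H:{H. H \<subseteq> S \<and> r \<in> H}. trees H \<times> forests (S - H)) (forests S)"
proof (rule bij_betw_byWitness[where f' = "\<lambda>A. let H = {y. conn A r y} in (H, {e \<in> A. e \<subseteq> H}, {e \<in> A. e \<subseteq> S - H})"])
  let ?D = "SIGMA H:{H. H \<subseteq> S \<and> r \<in> H}. trees H \<times> forests (S - H)"
  show "\<forall>p\<in>?D. (\<lambda>A. let H = {y. conn A r y} in (H, {e \<in> A. e \<subseteq> H}, {e \<in> A. e \<subseteq> S - H}))
      (case p of (H, A, B) \<Rightarrow> A \<union> B) = p"
  proof
    fix p assume "p \<in> ?D"
    then obtain H A B where p: "p = (H, A, B)" "H \<subseteq> S" "r \<in> H" "A \<in> trees H" "B \<in> forests (S - H)" by auto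
    have "{y. conn (A \<union> B) r y} = H" using trees_Un_component p by blast
    moreover have "{e \<in> A \<union> B. e \<subseteq> H} = A" using forests_Un_restrict[OF trees_forests] p by blast
    moreover have "{e \<in> A \<union> B. e \<subseteq> S - H} = B"
      using forests_Un_restrict[of B "S - H" A H] p trees_forests by (auto simp: Un_commute)
    ultimately show "(\<lambda>A. let H = {y. conn A r y} in (H, {e \<in> A. e \<subseteq> H}, {e \<in> A. e \<subseteq> S - H}))
      (case p of (H, A, B) \<Rightarrow> A \<union> B) = p" by (simp add: p Let_def)
  qed
  show "\<forall>A\<in>forests S. (case (let H = {y. conn A r y} in (H, {e \<in> A. e \<subseteq> H}, {e \<in> A. e \<subseteq> S - H})) of
      (H, A, B) \<Rightarrow> A \<union> B) = A"
    using forest_split(4)[OF _ r refl] by (simp add: Let_def)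
  show "(\<lambda>(H, A, B). A \<union> B) ` ?D \<subseteq> forests S"
  proof clarify
    fix H A B assume "H \<subseteq> S" "r \<in> H" "A \<in> trees H" "B \<in> forests (S - H)"
    then show "A \<union> B \<in> forests S" using forests_Un[OF trees_forests, of A H B "S - H"] by (simp add: Un_absorb1)
  qed
  show "(\<lambda>A. let H = {y. conn A r y} in (H, {e \<in> A. e \<subseteq> H}, {e \<in> A. e \<subseteq> S - H})) ` forests S \<subseteq> ?D"
  proof (rule image_subsetI)
    fix A assume "A \<in> forests S"
    from forest_split(1-3)[OF this r refl]
    show "(let H = {y. conn A r y} in (H, {e \<in> A. e \<subseteq> H}, {e \<in> A. e \<subseteq> S - H})) \<in> ?D"
      by (simp add: Let_def)
  qed
qed

lemma forests_component_sum:
  fixes f :: "'a set set \<Rightarrow> real"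
  assumes "finite S" "r \<in> S"
  shows "(\<Sum>A\<in>forests S. f A) =
    (\<Sum>H | H \<subseteq> S \<and> r \<in> H. \<Sum>A\<in>trees H. \<Sum>B\<in>forests (S - H). f (A \<union> B))"
proof -
  have fin: "finite H" if "H \<subseteq> S" for H using that assms(1) finite_subset by blast
  have "(\<Sum>A\<in>forests S. f A) =
    (\<Sum>p\<in>(SIGMA H:{H. H \<subseteq> S \<and> r \<in> H}. trees H \<times> forests (S - H)). f (case p of (H, A, B) \<Rightarrow> A \<union> B))"
    by (rule sum.reindex_bij_betw[OF forests_component_bij[OF assms(2)], symmetric])
  also have "\<dots> = (\<Sum>H | H \<subseteq> S \<and> r \<in> H. \<Sum>(A, B)\<in>trees H \<times> forests (S - H). f (A \<union> B))"
    by (subst sum.Sigma) (use assms fin in \<open>auto intro!: sum.cong\<close>)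
  finally show ?thesis by (simp add: sum.cartesian_product)
qed

section \<open>Two-component forests sorted by the component avoiding \<open>r\<close>\<close>

lemma rooted_pair_iff:
  assumes "r \<in> S" "v \<in> S" "v \<noteq> r"
  shows "A \<in> rooted S {v, r} \<longleftrightarrow> A \<in> forests S \<and> \<not> conn A v r \<and> (\<forall>x\<in>S. conn A x v \<or> conn A x r)"
proof
  assume A: "A \<in> rooted S {v, r}"
  then show "A \<in> forests S \<and> \<not> conn A v r \<and> (\<forall>x\<in>S. conn A x v \<or> conn A x r)"
    using rooted_forest[OF A] rooted_unique[OF A assms(2), of v r] rooted_root[OF A] assms(3) by auto
next
  assume A: "A \<in> forests S \<and> \<not> conn A v r \<and> (\<forall>x\<in>S. conn A x v \<or> conn A x r)"
  show "A \<in> rooted S {v, r}"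
  proof (rule rootedI)
    fix x a b assume "x \<in> S" "conn A x a" "conn A x b" "a \<in> {v, r}" "b \<in> {v, r}"
    then show "a = b" using A conn_sym conn_trans by (metis insertE singletonD)
  qed (use A in auto)
qed

lemma rooted_pair_Un_iff:
  assumes "C \<subseteq> S" "A \<in> trees C" "B \<in> forests (S - C)" "r \<in> S" "v \<in> C"
  shows "A \<union> B \<in> rooted S {v, r} \<and> v \<noteq> r \<longleftrightarrow> r \<notin> C \<and> B \<in> trees (S - C)"
proof
  have A: "A \<in> forests C" using assms trees_forests by blast
  have AB: "A \<union> B \<in> forests S" using forests_Un[OF A assms(3)] assms(1) by (simp add: Un_absorb1)
  have cv: "conn (A \<union> B) v y \<longleftrightarrow> y \<in> C" for y
    using trees_Un_component[OF assms(2,3) _ assms(5)] by auto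
  have cB: "conn (A \<union> B) x y \<longleftrightarrow> conn B x y" if "x \<in> S - C" for x y
    using forests_Un_conn[OF assms(3) A _ that] by (auto simp: Un_commute)
  {
    assume *: "A \<union> B \<in> rooted S {v, r} \<and> v \<noteq> r"
    then have rt: "\<not> conn (A \<union> B) v r" "\<And>x. x \<in> S \<Longrightarrow> conn (A \<union> B) x v \<or> conn (A \<union> B) x r"
      using rooted_pair_iff[of r S v "A \<union> B"] assms by auto
    then have rC: "r \<notin> C" using cv by simp
    have "conn B x r" if "x \<in> S - C" for x
      using rt(2)[of x] cv cB[OF that] that conn_sym by (metis DiffE)
    then have "\<And>x y. x \<in> S - C \<Longrightarrow> y \<in> S - C \<Longrightarrow> conn B x y" using conn_sym conn_trans by metis
    then show "r \<notin> C \<and> B \<in> trees (S - C)" using rC assms by (auto simp: trees_def)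
  }
  {
    assume *: "r \<notin> C \<and> B \<in> trees (S - C)"
    then have vr: "v \<noteq> r" using assms by auto
    have "conn (A \<union> B) x v \<or> conn (A \<union> B) x r" if "x \<in> S" for x
    proof (cases "x \<in> C")
      case True
      then show ?thesis using cv conn_sym by metis
    next
      case False
      then show ?thesis using cB[of x r] * that assms(4) by (auto simp: trees_def)
    qed
    then show "A \<union> B \<in> rooted S {v, r} \<and> v \<noteq> r"
      using rooted_pair_iff[of r S v] AB vr cv * assms by auto
  }
qed

lemma rooted_pair_sum:
  fixes f :: "'a set set \<Rightarrow> real"
  assumes fin: "finite S" and r: "r \<in> S" and v: "v \<in> S - {r}"
  shows "(\<Sum>A\<in>rooted S {v, r}. f A) =
    (\<Sum>C | C \<subseteq> S - {r} \<and> v \<in> C. \<Sum>A\<in>trees C. \<Sum>B\<in>trees (S - C). f (A \<union> B))"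
proof -
  have "(\<Sum>A\<in>rooted S {v, r}. f A) = (\<Sum>A\<in>forests S. of_bool (A \<in> rooted S {v, r}) * f A)"
    by (rule sum.mono_neutral_cong_left) (use fin in \<open>auto dest: rooted_forest\<close>)
  also have "\<dots> = (\<Sum>H | H \<subseteq> S \<and> v \<in> H. \<Sum>A\<in>trees H. \<Sum>B\<in>forests (S - H). of_bool (A \<union> B \<in> rooted S {v, r}) * f (A \<union> B))"
    by (rule forests_component_sum) (use fin v in auto)
  also have "\<dots> = (\<Sum>H | H \<subseteq> S \<and> v \<in> H. \<Sum>A\<in>trees H. \<Sum>B\<in>forests (S - H). of_bool (r \<notin> H \<and> B \<in> trees (S - H)) * f (A \<union> B))"
    using rooted_pair_Un_iff[of _ S _ _ r v] r v by (intro sum.cong refl) (auto simp: of_bool_def)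
  also have "\<dots> = (\<Sum>H | H \<subseteq> S \<and> v \<in> H. of_bool (r \<notin> H) * (\<Sum>A\<in>trees H. \<Sum>B\<in>trees (S - H). f (A \<union> B)))"
  proof (intro sum.cong refl)
    fix H assume "H \<in> {H. H \<subseteq> S \<and> v \<in> H}"
    have "(\<Sum>B\<in>forests (S - H). of_bool (r \<notin> H \<and> B \<in> trees (S - H)) * f (A \<union> B)) =
        of_bool (r \<notin> H) * (\<Sum>B\<in>trees (S - H). f (A \<union> B))" for A
      unfolding sum_distrib_left
      by (rule sum.mono_neutral_cong_right) (use fin in \<open>auto dest: trees_forests\<close>)
    then show "(\<Sum>A\<in>trees H. \<Sum>B\<in>forests (S - H). of_bool (r \<notin> H \<and> B \<in> trees (S - H)) * f (A \<union> B)) =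
      of_bool (r \<notin> H) * (\<Sum>A\<in>trees H. \<Sum>B\<in>trees (S - H). f (A \<union> B))"
      by (simp add: sum_distrib_left)
  qed
  also have "\<dots> = (\<Sum>C | C \<subseteq> S - {r} \<and> v \<in> C. \<Sum>A\<in>trees C. \<Sum>B\<in>trees (S - C). f (A \<union> B))"
    by (rule sum.mono_neutral_cong_right) (use fin in auto)
  finally show ?thesis .
qed

text \<open>Adding the edge \<open>yx\<close> joins the components of the two roots. In
  \<open>sum_rooted_edges\<close> this turns forests with a third root into occurrences of an
  edge.\<close>

lemma card_rooted_edge:
  assumes fin: "finite S" and R: "R \<subseteq> S" "x \<in> R" and y: "y \<in> nb S x" "y \<notin> R"
  shows "card (rooted S (insert y R)) = card {A \<in> rooted S R. {x, y} \<in> A}"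
proof (rule bij_betw_same_card[of "insert {y, x}"], rule bij_betwI')
  have yS: "y \<in> S" and xS: "x \<in> S" using y R by (auto simp: nb_def)
  have xy: "x \<noteq> y" using R y by auto
  have apart: "\<not> conn A y x" if "A \<in> rooted S (insert y R)" for A
    using rooted_roots_apart[OF that, of y x] R yS xy by auto
  have notin: "{y, x} \<notin> A" if "A \<in> rooted S (insert y R)" for A
    using apart[OF that] conn_edge by metis
  show "(insert {y, x} A = insert {y, x} B) = (A = B)"
    if "A \<in> rooted S (insert y R)" "B \<in> rooted S (insert y R)" for A B
    by (rule insert_ident[OF notin[OF that(1)] notin[OF that(2)]])
  show "insert {y, x} A \<in> {A \<in> rooted S R. {x, y} \<in> A}" if "A \<in> rooted S (insert y R)" for A
    using rooted_add_edge[OF that yS y(2) R(1) _ apart[OF that]] y(1) xS yS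
    by (auto simp: nb_def insert_commute)
  show "\<exists>A\<in>rooted S (insert y R). B = insert {y, x} A" if B: "B \<in> {A \<in> rooted S R. {x, y} \<in> A}" for B
  proof -
    obtain A z where A: "A \<in> rooted S (insert y R)" "B = insert {y, z} A"
      using rooted_remove_edge[OF _ yS y(2) R(1)] B by blast
    have "{y, x} \<in> B" using B by (auto simp: insert_commute)
    then have "{y, x} = {y, z}" using A(2) notin[OF A(1)] by blast
    then show ?thesis using A by auto
  qed
qed

lemma forest_handshake:
  assumes "finite S" "A \<in> forests S"
  shows "(\<Sum>x\<in>S. card {y. {x, y} \<in> A}) = 2 * card A"
proof -
  have fA: "finite A" using finite_forest assms by blast
  have "card {y. {x, y} \<in> A} = (\<Sum>e\<in>A. of_bool (x \<in> e))" for x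
  proof -
    have "card {y. {x, y} \<in> A} = card {e \<in> A. x \<in> e}"
    proof (rule bij_betw_same_card[of "\<lambda>y. {x, y}"], rule bij_betwI')
      fix e assume e: "e \<in> {e \<in> A. x \<in> e}"
      then obtain a b where "e = {a, b}" using forest_edge_cases[OF assms(2)] by blast
      with e show "\<exists>y\<in>{y. {x, y} \<in> A}. e = {x, y}" by (auto simp: insert_commute)
    qed (auto simp: doubleton_eq_iff)
    then show ?thesis using fA by (simp add: of_bool_def sum.If_cases Int_def)
  qed
  then have "(\<Sum>x\<in>S. card {y. {x, y} \<in> A}) = (\<Sum>e\<in>A. \<Sum>x\<in>S. of_bool (x \<in> e))"
    by (simp add: sum.swap[of _ S])
  also have "\<dots> = (\<Sum>e\<in>A. 2)"
  proof (rule sum.cong[OF refl])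
    fix e assume "e \<in> A"
    then have "card e = 2" "e \<subseteq> S" using assms edge_card by (auto simp: forests_def)
    then show "(\<Sum>x\<in>S. of_bool (x \<in> e)) = (2 :: nat)"
      using assms(1) by (simp add: of_bool_def sum.If_cases Int_absorb1)
  qed
  finally show ?thesis by simp
qed

text \<open>For \<open>r\<close> in \<open>S\<close> this is the \<open>F\<^sub>2\<close> of the
  opening sketch: \<open>C\<close> is the component avoiding \<open>r\<close>, and
  \<open>C = {}\<close> contributes nothing.\<close>

definition two_trees :: "'a \<Rightarrow> 'a set \<Rightarrow> real" where
  "two_trees r S = (\<Sum>C\<in>Pow (S - {r}). T C * T (S - C))"

lemma sum_vertex_subsets:
  fixes f :: "'a set \<Rightarrow> 'a \<Rightarrow> real"
  assumes "finite U"
  shows "(\<Sum>v\<in>U. \<Sum>C | C \<subseteq> U \<and> v \<in> C. f C v) = (\<Sum>C\<in>Pow U. \<Sum>v\<in>C. f C v)"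
proof -
  have "(\<Sum>v\<in>U. \<Sum>C | C \<subseteq> U \<and> v \<in> C. f C v) = (\<Sum>v\<in>U. \<Sum>C\<in>{C \<in> Pow U. v \<in> C}. f C v)"
    by (intro sum.cong refl) auto
  also have "\<dots> = (\<Sum>C\<in>Pow U. \<Sum>v\<in>{v \<in> U. v \<in> C}. f C v)"
    by (rule sum.swap_restrict) (use assms in auto)
  also have "\<dots> = (\<Sum>C\<in>Pow U. \<Sum>v\<in>C. f C v)"
    by (intro sum.cong refl) auto
  finally show ?thesis .
qed

text \<open>Each forest with two components is counted once for every vertex of the component
  avoiding \<open>r\<close>.\<close>

lemma sum_rooted_vertices:
  assumes "finite S" "r \<in> S"
  shows "(\<Sum>v\<in>S - {r}. real (card (rooted S {v, r}))) =
    (\<Sum>C\<in>Pow (S - {r}). real (card C) * (T C * T (S - C)))"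
proof -
  have "(\<Sum>v\<in>S - {r}. real (card (rooted S {v, r}))) =
      (\<Sum>v\<in>S - {r}. \<Sum>C | C \<subseteq> S - {r} \<and> v \<in> C. T C * T (S - C))"
    using rooted_pair_sum[OF assms, of _ "\<lambda>_. 1"] by (intro sum.cong refl) simp
  also have "\<dots> = (\<Sum>C\<in>Pow (S - {r}). real (card C) * (T C * T (S - C)))"
    by (subst sum_vertex_subsets) (use assms in auto)
  finally show ?thesis .
qed

text \<open>For fixed \<open>x\<close> the inner sum adds up the degrees of \<open>x\<close> in the
  two-component forests separating \<open>x\<close> from \<open>r\<close>. Summed over all vertices
  of a component \<open>C\<close>, the degrees give twice the number of edges of a tree on
  \<open>C\<close>.\<close>

lemma sum_rooted_edges:
  assumes "finite S" "r \<in> S"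
  shows "(\<Sum>x\<in>S - {r}. \<Sum>y\<in>nb (S - {r}) x. real (card (rooted S {y, x, r}))) =
    (\<Sum>C\<in>Pow (S - {r}). 2 * (real (card C) - 1) * (T C * T (S - C)))"
proof -
  let ?deg = "\<lambda>A x. real (card {y. {x, y} \<in> A})"
  have "(\<Sum>y\<in>nb (S - {r}) x. real (card (rooted S {y, x, r}))) =
      (\<Sum>C | C \<subseteq> S - {r} \<and> x \<in> C. \<Sum>A\<in>trees C. \<Sum>B\<in>trees (S - C). ?deg A x)"
    if x: "x \<in> S - {r}" for x
  proof -
    have "(\<Sum>y\<in>nb (S - {r}) x. real (card (rooted S {y, x, r}))) =
        (\<Sum>y\<in>nb (S - {r}) x. \<Sum>A\<in>rooted S {x, r}. of_bool ({x, y} \<in> A))"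
    proof (rule sum.cong[OF refl])
      fix y assume y: "y \<in> nb (S - {r}) x"
      then have "y \<noteq> x" "y \<noteq> r" "y \<in> nb S x" using nb_not_self by (auto simp: nb_def)
      then have "card (rooted S {y, x, r}) = card {A \<in> rooted S {x, r}. {x, y} \<in> A}"
        using card_rooted_edge[of S "{x, r}" x y] assms x by auto
      then show "real (card (rooted S {y, x, r})) = (\<Sum>A\<in>rooted S {x, r}. of_bool ({x, y} \<in> A))"
        using assms(1) by (simp add: of_bool_def sum.If_cases Int_def)
    qed
    also have "\<dots> = (\<Sum>A\<in>rooted S {x, r}. \<Sum>y\<in>nb (S - {r}) x. of_bool ({x, y} \<in> A))"
      by (rule sum.swap)
    also have "\<dots> = (\<Sum>A\<in>rooted S {x, r}. ?deg A x)"
    proof (rule sum.cong[OF refl])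
      fix A assume A: "A \<in> rooted S {x, r}"
      have "{x, r} \<notin> A"
        using rooted_roots_apart[OF A, of x r] conn_edge[of x r A] x assms by auto
      then have "{y. {x, y} \<in> A} = {y \<in> nb (S - {r}) x. {x, y} \<in> A}"
        using rooted_forest[OF A] by (auto simp: forests_def nb_def)
      then show "(\<Sum>y\<in>nb (S - {r}) x. of_bool ({x, y} \<in> A)) = ?deg A x"
        using assms(1) by (simp add: of_bool_def sum.If_cases Int_def)
    qed
    also have "\<dots> = (\<Sum>C | C \<subseteq> S - {r} \<and> x \<in> C. \<Sum>A\<in>trees C. \<Sum>B\<in>trees (S - C). ?deg (A \<union> B) x)"
      by (rule rooted_pair_sum[OF assms x])
    also have "\<dots> = (\<Sum>C | C \<subseteq> S - {r} \<and> x \<in> C. \<Sum>A\<in>trees C. \<Sum>B\<in>trees (S - C). ?deg A x)"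
    proof (intro sum.cong refl)
      fix C A B assume "C \<in> {C. C \<subseteq> S - {r} \<and> x \<in> C}" "B \<in> trees (S - C)"
      then have "{x, y} \<notin> B" for y by (auto simp: trees_def forests_def)
      then show "?deg (A \<union> B) x = ?deg A x" by simp
    qed
    finally show ?thesis .
  qed
  then have "(\<Sum>x\<in>S - {r}. \<Sum>y\<in>nb (S - {r}) x. real (card (rooted S {y, x, r}))) =
      (\<Sum>x\<in>S - {r}. \<Sum>C | C \<subseteq> S - {r} \<and> x \<in> C. \<Sum>A\<in>trees C. \<Sum>B\<in>trees (S - C). ?deg A x)"
    by simp
  also have "\<dots> = (\<Sum>C\<in>Pow (S - {r}). \<Sum>x\<in>C. \<Sum>A\<in>trees C. \<Sum>B\<in>trees (S - C). ?deg A x)"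
    by (rule sum_vertex_subsets) (use assms in simp)
  also have "\<dots> = (\<Sum>C\<in>Pow (S - {r}). \<Sum>A\<in>trees C. \<Sum>B\<in>trees (S - C). \<Sum>x\<in>C. ?deg A x)"
    by (intro sum.cong refl) (simp add: sum.swap[of _ _ "trees _"] sum_distrib_left)
  also have "\<dots> = (\<Sum>C\<in>Pow (S - {r}). 2 * (real (card C) - 1) * (T C * T (S - C)))"
  proof (intro sum.cong refl)
    fix C assume "C \<in> Pow (S - {r})"
    then have fC: "finite C" using assms finite_subset by auto
    have "(\<Sum>x\<in>C. ?deg A x) = 2 * (real (card C) - 1)" if "A \<in> trees C" for A
    proof -
      have "(\<Sum>x\<in>C. ?deg A x) = real (2 * card A)"
        unfolding forest_handshake[OF fC trees_forests[OF that], symmetric] by simp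
      moreover have "real (card A) + 1 = real (card C)"
        using card_tree[OF fC that] by linarith
      ultimately show ?thesis by simp
    qed
    then show "(\<Sum>A\<in>trees C. \<Sum>B\<in>trees (S - C). \<Sum>x\<in>C. ?deg A x) = 2 * (real (card C) - 1) * (T C * T (S - C))"
      by simp
  qed
  finally show ?thesis .
qed

text \<open>The component avoiding \<open>r\<close> is a tree, so it has one more vertex than edges.\<close>

lemma two_trees_euler:
  assumes "finite S" "r \<in> S"
  shows "two_trees r S = (\<Sum>v\<in>S - {r}. real (card (rooted S {v, r}))) -
    (\<Sum>x\<in>S - {r}. \<Sum>y\<in>nb (S - {r}) x. real (card (rooted S {y, x, r}))) / 2"
  unfolding sum_rooted_vertices[OF assms] sum_rooted_edges[OF assms] two_trees_def
    sum_divide_distrib sum_subtractf[symmetric]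
  by (intro sum.cong refl) (simp add: field_simps)

section \<open>Spanning forests with two components\<close>

lemma sum_nb_swap:
  fixes F :: "'a \<Rightarrow> 'a \<Rightarrow> real"
  assumes "finite U"
  shows "(\<Sum>x\<in>U. \<Sum>y\<in>nb U x. F x y) = (\<Sum>x\<in>U. \<Sum>y\<in>nb U x. F y x)"
proof -
  have "(\<Sum>x\<in>U. \<Sum>y\<in>nb U x. F x y) = (\<Sum>x\<in>U. \<Sum>y\<in>{y\<in>U. {x, y} \<in> E}. F x y)"
    by (simp add: nb_def)
  also have "\<dots> = (\<Sum>y\<in>U. \<Sum>x\<in>{x\<in>U. {x, y} \<in> E}. F x y)"
    by (rule sum.swap_restrict) (use assms in auto)
  finally show ?thesis by (simp add: nb_def insert_commute)
qed

text \<open>The adjacency part is symmetric and the diagonal cancels. The diagonal \<open>d\<close>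
  is arbitrary because degrees will be taken in a larger graph than the one on
  \<open>U\<close>.\<close>

lemma green_identity:
  fixes d f h :: "'a \<Rightarrow> real"
  assumes "finite U"
  shows "(\<Sum>z\<in>U. f z * (d z * h z - (\<Sum>w\<in>nb U z. h w))) =
    (\<Sum>z\<in>U. h z * (d z * f z - (\<Sum>w\<in>nb U z. f w)))"
proof -
  have "(\<Sum>z\<in>U. \<Sum>w\<in>nb U z. f z * h w) = (\<Sum>z\<in>U. \<Sum>w\<in>nb U z. h z * f w)"
    by (subst sum_nb_swap[OF assms]) (simp add: mult.commute)
  then show ?thesis
    by (simp add: right_diff_distrib sum_subtractf sum_distrib_left mult.commute mult.left_commute)
qed

lemma sum_nb_restrict:
  fixes f :: "'a \<Rightarrow> real"
  assumes "finite S" "W \<subseteq> S" "\<And>w. w \<in> S - W \<Longrightarrow> f w = 0"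
  shows "(\<Sum>w\<in>nb S z. f w) = (\<Sum>w\<in>nb W z. f w)"
  by (rule sum.mono_neutral_right) (use assms in \<open>auto simp: nb_def\<close>)

text \<open>Both sides count the two-component forests in which \<open>x\<close> and
  \<open>y\<close> lie together, apart from \<open>r\<close>.\<close>

lemma linked_sym:
  assumes "r \<in> S" "x \<in> S - {r}" "y \<in> S - {r}"
  shows "linked S {r} x y = linked S {r} y x"
proof -
  have "{A \<in> rooted S {y, r}. conn A x y} = {A \<in> rooted S {x, r}. conn A y x}"
    using rooted_pair_iff[of r S x] rooted_pair_iff[of r S y] assms
    by (auto intro: conn_sym conn_trans)
  then show ?thesis by (simp add: linked_def)
qed

lemma linked_le_self:
  assumes "finite S"
  shows "linked S R x y \<le> linked S R y y"
  unfolding linked_self unfolding linked_def of_nat_le_iff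
  by (rule card_mono) (use assms in auto)

text \<open>The Laplacian without the rows and columns of \<open>R\<close>, times the Green
  function, is the identity. Degrees still count neighbours in \<open>R\<close>, whose summands
  vanish by \<open>linked_root\<close>.\<close>

lemma linked_laplace_of_bool:
  assumes "finite S" "R \<subseteq> S" "y \<in> S - R" "x \<in> S - R" "card (rooted S R) > 0"
  shows "card (nb S x) * (linked S R x y / card (rooted S R)) =
    of_bool (x = y) + (\<Sum>z\<in>nb (S - R) x. linked S R z y / card (rooted S R))"
proof -
  have "(\<Sum>z\<in>nb S x. linked S R z y) = (\<Sum>z\<in>nb (S - R) x. linked S R z y)"
    by (rule sum_nb_restrict) (use assms linked_root in auto)
  then have "card (nb S x) * linked S R x y =
      of_bool (x = y) * card (rooted S R) + (\<Sum>z\<in>nb (S - R) x. linked S R z y)"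
    using linked_laplace_self[of S R y] linked_laplace[of S R y x] assms by (cases "x = y") auto
  then show ?thesis
    using assms(5) by (simp add: sum_divide_distrib[symmetric] field_simps)
qed

text \<open>Divided by \<open>g x x\<close>, both sides are the value at \<open>(y, y)\<close> of the Green function of the walk
  killed at \<open>{x, r}\<close>.\<close>

lemma rooted_triple_eq_minor:
  assumes fin: "finite S" and r: "r \<in> S" and x: "x \<in> S - {r}" and y: "y \<in> S - {r}" and xy: "x \<noteq> y"
    and T: "T S > 0"
  defines "g \<equiv> \<lambda>x y. linked S {r} x y / T S"
  shows "card (rooted S {y, x, r}) / T S = g x x * g y y - (g x y)\<^sup>2"
proof -
  define W where "W = S - {x, r}"
  define n where "n = card (rooted S {x, r})"
  define d where "d = (\<lambda>z. real (card (nb S z)))"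
  define h where "h = (\<lambda>z. linked S {x, r} z y / n)"
  \<comment> \<open>A multiple of the column of \<open>x\<close> is subtracted from the column of
    \<open>y\<close> so that \<open>f\<close> vanishes at \<open>x\<close>: a Schur
    complement.\<close>
  define f where "f = (\<lambda>z. g z y - g z x * g x y / g x x)"
  have fW: "finite W" using fin by (simp add: W_def)
  have yW: "y \<in> W" using y xy by (auto simp: W_def)
  have T': "T S = real (card (rooted S {r}))" using r by (simp add: trees_eq_rooted)
  have lap: "d z * g z v = of_bool (z = v) + (\<Sum>w\<in>nb (S - {r}) z. g w v)"
    if "z \<in> S - {r}" "v \<in> S - {r}" for z v
    using linked_laplace_of_bool[of S "{r}" v z] fin r that T unfolding g_def d_def T' by simp
  have g0: "g z v \<ge> 0" for z v by (simp add: g_def linked_def)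
  have "d x * g x x \<ge> 1" using lap[OF x x] g0 by (simp add: sum_nonneg)
  then have gx: "g x x > 0" using g0[of x x] by (cases "g x x = 0") auto
  have n: "real n = T S * g x x" using T by (simp add: g_def n_def linked_self)
  then have n0: "n > 0" using T gx by (metis mult_pos_pos of_nat_0_less_iff)
  have laph: "d z * h z - (\<Sum>w\<in>nb W z. h w) = of_bool (z = y)" if "z \<in> W" for z
    using linked_laplace_of_bool[of S "{x, r}" y z] fin r x yW that n0
    unfolding h_def d_def n_def W_def by simp
  have lapf: "d z * f z - (\<Sum>w\<in>nb W z. f w) = of_bool (z = y)" if z: "z \<in> W" for z
  proof -
    have fx: "f x = 0" using gx by (simp add: f_def)
    have zS: "z \<in> S - {r}" "z \<noteq> x" using z by (auto simp: W_def)
    have "(\<Sum>w\<in>nb W z. f w) = (\<Sum>w\<in>nb (S - {r}) z. f w)"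
      by (rule sum_nb_restrict[symmetric]) (use fin fx in \<open>auto simp: W_def\<close>)
    also have "\<dots> = (\<Sum>w\<in>nb (S - {r}) z. g w y) - (\<Sum>w\<in>nb (S - {r}) z. g w x) * g x y / g x x"
      by (simp add: f_def sum_subtractf sum_distrib_right sum_divide_distrib)
    also have "\<dots> = (d z * g z y - of_bool (z = y)) - d z * g z x * g x y / g x x"
      using lap[OF zS(1) y] lap[OF zS(1) x] zS(2) by simp
    also have "\<dots> = d z * f z - of_bool (z = y)"
      by (simp add: f_def algebra_simps)
    finally show ?thesis by simp
  qed
  \<comment> \<open>\<open>f\<close> and \<open>h\<close> solve the same equation with source at
    \<open>y\<close>, so pairing them by \<open>green_identity\<close> gives
    \<open>f y = h y\<close>.\<close>
  have "(\<Sum>z\<in>W. f z * of_bool (z = y)) = (\<Sum>z\<in>W. h z * of_bool (z = y))"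
    using green_identity[OF fW, of f d h] laph lapf by simp
  then have "f y = h y" using fW yW by (simp add: of_bool_def if_distrib cong: if_cong)
  moreover have "h y = card (rooted S {y, x, r}) / n" by (simp add: h_def linked_self)
  ultimately have "card (rooted S {y, x, r}) = n * f y" using n0 by simp
  then have "card (rooted S {y, x, r}) = T S * g x x * f y" unfolding n .
  also have "\<dots> = T S * (g x x * g y y - g y x * g x y)" using gx by (simp add: f_def field_simps)
  also have "g y x = g x y" using linked_sym[OF r x y] by (simp add: g_def)
  finally show ?thesis using T by (simp add: power2_eq_square field_simps)
qed

text \<open>The degree of \<open>r\<close> is counted in \<open>V\<close> rather than in
  \<open>S\<close>: this weaker bound has the same factor for every \<open>S\<close>, as the sum in
  \<open>planted_poly_diff_ineq\<close> requires.\<close>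

lemma two_trees_lower_bound:
  assumes finV: "finite V" and SV: "S \<subseteq> V" and r: "r \<in> S" and S: "S \<noteq> {r}"
  shows "two_trees r S \<ge> (1/2 + 1 / (2 * card (nb V r))) * T S"
proof (cases "T S = 0")
  case True
  then show ?thesis by (simp add: two_trees_def sum_nonneg)
next
  case False
  then have T: "T S > 0" by simp
  have fin: "finite S" using finV SV finite_subset by blast
  define U where "U = S - {r}"
  define d where "d = (\<lambda>z. real (card (nb S z)))"
  define g where "g = (\<lambda>x y. linked S {r} x y / T S)"
  have fU: "finite U" using fin by (simp add: U_def)
  have T': "T S = real (card (rooted S {r}))" using r by (simp add: trees_eq_rooted)
  have lap: "d z * g z v = of_bool (z = v) + (\<Sum>w\<in>nb U z. g w v)" if "z \<in> U" "v \<in> U" for z v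
    using linked_laplace_of_bool[of S "{r}" v z] fin r that T unfolding g_def d_def T' U_def by simp
  have g0: "g z v \<ge> 0" for z v by (simp add: g_def linked_def)
  have sym: "g x y = g y x" if "x \<in> U" "y \<in> U" for x y
    using linked_sym[OF r] that by (simp add: g_def U_def)
  have dom: "g x y \<le> g y y" for x y
    using linked_le_self[OF fin] T by (simp add: g_def divide_right_mono)
  have dg: "d x * g x x = 1 + (\<Sum>y\<in>nb U x. g x y)" if x: "x \<in> U" for x
  proof -
    have "(\<Sum>y\<in>nb U x. g y x) = (\<Sum>y\<in>nb U x. g x y)"
      using x sym by (intro sum.cong) (auto simp: nb_def)
    then show ?thesis using lap[OF x x] by simp
  qed
  have d1: "d x > 0" if "x \<in> U" for x
  proof -
    have "d x * g x x \<ge> 1" using dg[OF that] g0 by (simp add: sum_nonneg)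
    then have "d x \<noteq> 0" by auto
    then show ?thesis by (simp add: d_def)
  qed
  \<comment> \<open>Makes each \<open>1 / (2 * d x)\<close> at least
    \<open>1 / (2 * card U)\<close>, so that together they reach \<open>1/2\<close>.\<close>
  have dU: "d x \<le> card U" if "x \<in> U" for x
  proof -
    have "nb S x \<subseteq> S - {x}" using nb_not_self by (auto simp: nb_def)
    then have "card (nb S x) \<le> card (S - {x})" using fin by (intro card_mono) auto
    also have "\<dots> = card U" using that r fin by (simp add: U_def)
    finally show ?thesis by (simp add: d_def)
  qed
  have card_nb: "real (card (nb U x)) = d x - of_bool (x \<in> nb S r)" if "x \<in> U" for x
  proof -
    have "nb S x = (if x \<in> nb S r then insert r (nb U x) else nb U x)"
      using that r by (auto simp: nb_def U_def insert_commute)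
    moreover have "r \<notin> nb U x" "finite (nb U x)" using fU by (auto simp: nb_def U_def)
    ultimately show ?thesis by (simp add: d_def)
  qed
  have nbr: "nb S r \<subseteq> U" using nb_not_self by (auto simp: U_def nb_def)
  obtain y where y: "y \<in> U" using S r by (auto simp: U_def)

  \<comment> \<open>The constant function is paired with the column of \<open>y\<close>. Its
    Laplacian is 1 at the neighbours of \<open>r\<close> and 0 elsewhere in \<open>U\<close>, so
    \<open>g z y\<close> sums to 1 over \<open>nb S r\<close>; and \<open>g z y \<le> g z z\<close>
    by symmetry and \<open>dom\<close>.\<close>
  have "1 = (\<Sum>z\<in>U. 1 * (d z * g z y - (\<Sum>w\<in>nb U z. g w y)))"
    using lap y fU by (simp add: of_bool_def)
  also have "\<dots> = (\<Sum>z\<in>U. g z y * (d z - real (card (nb U z))))"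
    by (subst green_identity[OF fU]) simp
  also have "\<dots> = (\<Sum>z\<in>U. of_bool (z \<in> nb S r) * g z y)"
    by (intro sum.cong refl) (simp add: card_nb)
  also have "\<dots> = (\<Sum>z\<in>nb S r. g z y)"
    using nbr fU by (intro sum.mono_neutral_cong_right) auto
  also have "\<dots> \<le> (\<Sum>z\<in>nb S r. g z z)"
    using dom sym y nbr by (intro sum_mono) (metis subsetD)
  finally have "1 \<le> (\<Sum>z\<in>nb S r. g z z)\<^sup>2" by simp
  also have "\<dots> \<le> d r * (\<Sum>z\<in>nb S r. (g z z)\<^sup>2)" unfolding d_def using sum_squared_le_sum_of_squares[of "\<lambda>z. g z z" "nb S r"] by (simp add: mult.commute)
  finally have *: "1 \<le> d r * (\<Sum>z\<in>nb S r. (g z z)\<^sup>2)" .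
  then have "d r \<noteq> 0" by auto
  then have "d r > 0" by (simp add: d_def)
  with * have near_root: "1 / d r \<le> (\<Sum>z\<in>nb S r. (g z z)\<^sup>2)" by (simp add: field_simps)

  have "(\<Sum>x\<in>U. \<Sum>y\<in>nb U x. g x x * g y y) \<le> (\<Sum>x\<in>U. \<Sum>y\<in>nb U x. ((g x x)\<^sup>2 + (g y y)\<^sup>2) / 2)"
  proof (intro sum_mono)
    fix x y
    have "0 \<le> (g x x - g y y)\<^sup>2" by simp
    then show "g x x * g y y \<le> ((g x x)\<^sup>2 + (g y y)\<^sup>2) / 2" by (simp add: power2_diff)
  qed
  also have "\<dots> = (\<Sum>x\<in>U. \<Sum>y\<in>nb U x. (g x x)\<^sup>2)"
    using sum_nb_swap[OF fU, of "\<lambda>x y. (g y y)\<^sup>2"]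
    by (simp add: add_divide_distrib sum.distrib flip: sum_divide_distrib)
  finally have prod: "(\<Sum>x\<in>U. \<Sum>y\<in>nb U x. g x x * g y y) \<le> (\<Sum>x\<in>U. card (nb U x) * (g x x)\<^sup>2)"
    by simp

  have vertex: "1 / (2 * d x) + of_bool (x \<in> nb S r) * (g x x)\<^sup>2 / 2 \<le>
      g x x - card (nb U x) * (g x x)\<^sup>2 / 2 + (\<Sum>y\<in>nb U x. (g x y)\<^sup>2) / 2" if x: "x \<in> U" for x
  proof -
    define s Q where "s = (\<Sum>y\<in>nb U x. g x y)" and "Q = (\<Sum>y\<in>nb U x. (g x y)\<^sup>2)"
    have Q0: "Q \<ge> 0" by (simp add: Q_def sum_nonneg)
    have "s\<^sup>2 \<le> card (nb U x) * Q" unfolding s_def Q_def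
      using sum_squared_le_sum_of_squares[of "g x" "nb U x"] by (simp add: mult.commute)
    also have "\<dots> \<le> d x * Q" using card_nb[OF x] Q0 by (intro mult_right_mono) auto
    finally have "s\<^sup>2 / d x \<le> Q" using d1[OF x] by (simp add: field_simps)
    \<comment> \<open>By \<open>dg\<close>, \<open>s = d x * g x x - 1\<close>, and expanding the
      square cancels every term in \<open>g x x\<close>.\<close>
    moreover have "g x x - d x * (g x x)\<^sup>2 / 2 + (s\<^sup>2 / d x) / 2 = 1 / (2 * d x)"
    proof -
      have "s = d x * g x x - 1" using dg[OF x] by (simp add: s_def)
      then show ?thesis
        by (rule ssubst) (use d1[OF x] in \<open>simp add: field_simps power2_eq_square\<close>)
    qed
    moreover have "a + b / 2 = c \<Longrightarrow> b \<le> q \<Longrightarrow> c \<le> a + q / 2" for a b c q :: real by simp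
    ultimately have "1 / (2 * d x) \<le> g x x - d x * (g x x)\<^sup>2 / 2 + Q / 2" by blast
    \<comment> \<open>At a neighbour of \<open>r\<close>, \<open>card (nb U x)\<close> is
      \<open>d x - 1\<close>, which leaves the additional
      \<open>(g x x)\<^sup>2 / 2\<close>.\<close>
    then show ?thesis unfolding card_nb[OF x] Q_def[symmetric] by (simp add: field_simps)
  qed

  have "1/2 \<le> (\<Sum>x\<in>U. 1 / (2 * d x))"
  proof -
    have c: "card U > 0" using y fU by (auto simp: card_gt_0_iff)
    have "1/2 = (\<Sum>x\<in>U. 1 / (2 * card U))" using c by simp
    also have "\<dots> \<le> (\<Sum>x\<in>U. 1 / (2 * d x))"
      using dU d1 c by (intro sum_mono divide_left_mono) auto
    finally show ?thesis .
  qed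
  moreover have "(\<Sum>x\<in>U. of_bool (x \<in> nb S r) * (g x x)\<^sup>2 / 2) = (\<Sum>x\<in>nb S r. (g x x)\<^sup>2) / 2"
    unfolding sum_divide_distrib by (rule sum.mono_neutral_cong_right) (use nbr fU in auto)
  ultimately have "1/2 + 1 / (2 * d r) \<le>
      (\<Sum>x\<in>U. 1 / (2 * d x) + of_bool (x \<in> nb S r) * (g x x)\<^sup>2 / 2)"
    using near_root by (simp add: sum.distrib)
  also have "\<dots> \<le> (\<Sum>x\<in>U. g x x - card (nb U x) * (g x x)\<^sup>2 / 2 + (\<Sum>y\<in>nb U x. (g x y)\<^sup>2) / 2)"
    by (intro sum_mono vertex)
  also have "\<dots> = (\<Sum>x\<in>U. g x x) - (\<Sum>x\<in>U. card (nb U x) * (g x x)\<^sup>2) / 2 + (\<Sum>x\<in>U. \<Sum>y\<in>nb U x. (g x y)\<^sup>2) / 2"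
    by (simp add: sum.distrib sum_subtractf sum_divide_distrib)
  also have "\<dots> \<le> (\<Sum>x\<in>U. g x x) - (\<Sum>x\<in>U. \<Sum>y\<in>nb U x. g x x * g y y - (g x y)\<^sup>2) / 2"
    using prod by (simp add: sum_subtractf diff_divide_distrib)
  \<comment> \<open>The minors count forests rooted at \<open>y\<close>, \<open>x\<close>,
    \<open>r\<close>, so \<open>two_trees_euler\<close> applies; the halved sums meet every edge
    twice.\<close>
  also have "\<dots> = two_trees r S / T S"
  proof -
    have "(\<Sum>x\<in>U. \<Sum>y\<in>nb U x. g x x * g y y - (g x y)\<^sup>2) =
        (\<Sum>x\<in>U. \<Sum>y\<in>nb U x. card (rooted S {y, x, r}) / T S)"
    proof (intro sum.cong refl)
      fix x y assume "x \<in> U" "y \<in> nb U x"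
      then have "x \<in> S - {r}" "y \<in> S - {r}" "x \<noteq> y" using nb_not_self by (auto simp: U_def nb_def)
      then show "g x x * g y y - (g x y)\<^sup>2 = card (rooted S {y, x, r}) / T S"
        unfolding g_def using rooted_triple_eq_minor[OF fin r _ _ _ T] by simp
    qed
    moreover have "(\<Sum>x\<in>U. g x x) = (\<Sum>x\<in>U. real (card (rooted S {x, r}))) / T S"
      by (simp add: g_def linked_self sum_divide_distrib)
    ultimately show ?thesis
      unfolding two_trees_euler[OF fin r] U_def
      by (simp add: diff_divide_distrib flip: sum_divide_distrib)
  qed
  finally have "(1/2 + 1 / (2 * d r)) * T S \<le> two_trees r S" using T by (simp add: pos_le_divide_eq)
  moreover have "1 / (2 * real (card (nb V r))) \<le> 1 / (2 * d r)"
  proof -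
    have "card (nb S r) \<le> card (nb V r)" using finV SV by (intro card_mono) (auto simp: nb_def)
    with \<open>d r > 0\<close> show ?thesis by (simp add: d_def frac_le)
  qed
  then have "(1/2 + 1 / (2 * card (nb V r))) * T S \<le> (1/2 + 1 / (2 * d r)) * T S"
    by (intro mult_right_mono) auto
  ultimately show ?thesis by linarith
qed

section \<open>The component generating function\<close>

lemma forests_empty [simp]: "forests {} = {{}}"
proof -
  have "A = {}" if "A \<in> forests {}" for A
    using forest_edge_cases[OF that] by blast
  moreover have "{} \<in> forests {}" by (simp add: forests_def)
  ultimately show ?thesis by blast
qed

lemma card_Un_forests:
  assumes "finite S" "H \<subseteq> S" "A \<in> forests H" "B \<in> forests (S - H)"
  shows "card (A \<union> B) = card A + card B"
proof (rule card_Un_disjoint)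
  show "finite A" "finite B" using finite_forest assms finite_subset by (meson finite_Diff)+
  show "A \<inter> B = {}"
  proof (rule ccontr)
    assume "A \<inter> B \<noteq> {}"
    then obtain e where e: "e \<in> A" "e \<in> B" by blast
    obtain x y where "e = {x, y}" "x \<in> H" using forest_edge_cases[OF assms(3) e(1)] by metis
    then show False using assms(4) e(2) by (auto simp: forests_def)
  qed
qed

text \<open>Ensures that the natural-number subtraction in \<open>card S - card A\<close> below
  never truncates.\<close>

lemma card_forest_le:
  assumes "finite S" "A \<in> forests S"
  shows "card A \<le> card S"
  using assms
proof (induction "card S" arbitrary: S A rule: less_induct)
  case less
  show ?case
  proof (cases "S = {}")
    case False
    then obtain r where r: "r \<in> S" by blast
    define H where "H = {y. conn A r y}"
    note split = forest_split[OF less.prems(2) r H_def]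
    let ?A = "{e \<in> A. e \<subseteq> H}" and ?B = "{e \<in> A. e \<subseteq> S - H}"
    have fH: "finite H" using split(1) less.prems finite_subset by blast
    have cS: "card S = card H + card (S - H)"
      using split(1) fH less.prems by (metis card_Diff_subset card_mono le_add_diff_inverse)
    have "r \<in> H" by (simp add: H_def)
    then have "card H > 0" using fH by (auto simp: card_gt_0_iff)
    then have "card ?B \<le> card (S - H)"
      using less.hyps[of "S - H" ?B] split(3) less.prems cS by simp
    moreover have "card ?A + 1 = card H" using card_tree[OF fH split(2)] .
    moreover have "card A = card ?A + card ?B"
      using card_Un_forests[OF less.prems(1) split(1) trees_forests[OF split(2)] split(3)] split(4) by simp
    ultimately show ?thesis using cS by linarith
  qed (use less.prems in auto)
qed

text \<open>A forest with edge set \<open>A\<close> on the vertex set \<open>S\<close> has \<open>card S - card A\<close> components.\<close>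

definition forest_poly :: "'a set \<Rightarrow> real \<Rightarrow> real" where
  "forest_poly S t = (\<Sum>A\<in>forests S. t ^ (card S - card A))"

lemma forest_poly_empty [simp]: "forest_poly {} t = 1"
  by (simp add: forest_poly_def)

lemma forest_poly_1: "forest_poly S 1 = card (forests S)"
  by (simp add: forest_poly_def)

lemma forest_poly_nonneg: "t \<ge> 0 \<Longrightarrow> forest_poly S t \<ge> 0"
  by (simp add: forest_poly_def sum_nonneg)

lemma forest_poly_pos:
  assumes "finite S" "t > 0"
  shows "forest_poly S t > 0"
proof -
  have "{} \<in> forests S" by (simp add: forests_def)
  then show ?thesis unfolding forest_poly_def using assms by (intro sum_pos) auto
qed

text \<open>The \<open>f\<close> of the opening sketch. The component \<open>H\<close> of
  \<open>r\<close> carries no factor \<open>t\<close>, which keeps the polynomial meaningful at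
  \<open>t = 0\<close>, where only trees remain.\<close>

definition planted_poly :: "'a \<Rightarrow> 'a set \<Rightarrow> real \<Rightarrow> real" where
  "planted_poly r S t = (\<Sum>H | H \<subseteq> S \<and> r \<in> H. T H * forest_poly (S - H) t)"

text \<open>The component of \<open>r\<close> is split off; a tree has one more vertex than edges,
  hence exactly one factor \<open>t\<close>.\<close>

lemma forest_poly_rec:
  assumes "finite S" "r \<in> S"
  shows "forest_poly S t = t * planted_poly r S t"
proof -
  have "forest_poly S t = (\<Sum>H | H \<subseteq> S \<and> r \<in> H. \<Sum>A\<in>trees H. \<Sum>B\<in>forests (S - H). t ^ (card S - card (A \<union> B)))"
    unfolding forest_poly_def by (rule forests_component_sum[OF assms])
  also have "\<dots> = (\<Sum>H | H \<subseteq> S \<and> r \<in> H. \<Sum>A\<in>trees H. \<Sum>B\<in>forests (S - H). t * t ^ (card (S - H) - card B))"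
  proof (intro sum.cong refl)
    fix H A B assume H: "H \<in> {H. H \<subseteq> S \<and> r \<in> H}" and A: "A \<in> trees H" and B: "B \<in> forests (S - H)"
    have fH: "finite H" using H assms finite_subset by blast
    have "card S = card H + card (S - H)"
      using H fH assms by (metis (no_types, lifting) card_Diff_subset card_mono le_add_diff_inverse mem_Collect_eq)
    moreover have "card A + 1 = card H" using card_tree[OF fH A] .
    moreover have "card B \<le> card (S - H)" using card_forest_le[OF _ B] assms by simp
    moreover have "card (A \<union> B) = card A + card B"
      using card_Un_forests[OF assms(1) _ trees_forests[OF A] B] H by simp
    ultimately have "card S - card (A \<union> B) = Suc (card (S - H) - card B)" by linarith
    then show "t ^ (card S - card (A \<union> B)) = t * t ^ (card (S - H) - card B)" by simp
  qed
  also have "\<dots> = t * planted_poly r S t"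
    by (simp add: planted_poly_def forest_poly_def mult.left_commute flip: sum_distrib_left)
  finally show ?thesis .
qed

lemma forest_poly_0: "finite S \<Longrightarrow> forest_poly S 0 = of_bool (S = {})"
  using forest_poly_rec[of S _ 0] by (cases "S = {}") auto

lemma sum_disjoint_pairs:
  fixes F :: "'a set \<Rightarrow> 'a set \<Rightarrow> real"
  assumes "finite S"
  shows "(\<Sum>H | H \<subseteq> S \<and> r \<in> H. \<Sum>A\<in>Pow (S - H). F H A) =
    (\<Sum>A\<in>Pow (S - {r}). \<Sum>H | H \<subseteq> S - A \<and> r \<in> H. F H A)"
proof -
  have "(\<Sum>H | H \<subseteq> S \<and> r \<in> H. \<Sum>A\<in>Pow (S - H). F H A) =
      (\<Sum>H\<in>{H \<in> Pow S. r \<in> H}. \<Sum>A\<in>{A \<in> Pow (S - {r}). A \<inter> H = {}}. F H A)"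
    by (intro sum.cong refl) auto
  also have "\<dots> = (\<Sum>A\<in>Pow (S - {r}). \<Sum>H\<in>{H \<in> {H \<in> Pow S. r \<in> H}. A \<inter> H = {}}. F H A)"
    by (rule sum.swap_restrict) (use assms in auto)
  also have "\<dots> = (\<Sum>A\<in>Pow (S - {r}). \<Sum>H | H \<subseteq> S - A \<and> r \<in> H. F H A)"
    by (intro sum.cong refl) auto
  finally show ?thesis .
qed

text \<open>Differentiating in \<open>t\<close> marks one of the components.\<close>

lemma forest_poly_deriv:
  assumes "finite S"
  shows "(forest_poly S has_real_derivative (\<Sum>A\<in>Pow S. T A * forest_poly (S - A) t)) (at t)"
  using assms
proof (induction "card S" arbitrary: S rule: less_induct)
  case less
  show ?case
  proof (cases "S = {}")
    case True
    then have "forest_poly S = (\<lambda>_. 1)" by auto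
    with True show ?thesis by simp
  next
    case False
    then obtain r where r: "r \<in> S" by blast
    have eq: "forest_poly S = (\<lambda>t. t * (\<Sum>H | H \<subseteq> S \<and> r \<in> H. T H * forest_poly (S - H) t))"
      using forest_poly_rec[OF less.prems r] by (simp add: fun_eq_iff planted_poly_def)
    have IH: "(forest_poly (S - H) has_real_derivative (\<Sum>A\<in>Pow (S - H). T A * forest_poly (S - H - A) t)) (at t)"
      if "H \<subseteq> S \<and> r \<in> H" for H
      using that less.prems r by (intro less.hyps psubset_card_mono) auto
    \<comment> \<open>The first sum of the product rule marks the component of \<open>r\<close>, the
      second one a component \<open>A\<close> that avoids \<open>r\<close>.\<close>
    have "(forest_poly S has_real_derivative
        (\<Sum>H | H \<subseteq> S \<and> r \<in> H. T H * forest_poly (S - H) t) +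
        (\<Sum>H | H \<subseteq> S \<and> r \<in> H. T H * (\<Sum>A\<in>Pow (S - H). T A * forest_poly (S - H - A) t)) * t) (at t)"
      unfolding eq by (rule DERIV_cong, rule DERIV_mult DERIV_ident DERIV_sum DERIV_cmult IH | simp)+
    also have "(\<Sum>H | H \<subseteq> S \<and> r \<in> H. T H * (\<Sum>A\<in>Pow (S - H). T A * forest_poly (S - H - A) t)) * t =
        (\<Sum>H | H \<subseteq> S \<and> r \<in> H. \<Sum>A\<in>Pow (S - H). T A * (t * (T H * forest_poly (S - A - H) t)))"
      by (simp add: sum_distrib_left sum_distrib_right mult_ac Diff_eq Int_ac)
    also have "\<dots> = (\<Sum>A\<in>Pow (S - {r}). \<Sum>H | H \<subseteq> S - A \<and> r \<in> H. T A * (t * (T H * forest_poly (S - A - H) t)))"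
      by (rule sum_disjoint_pairs[OF less.prems])
    also have "\<dots> = (\<Sum>A\<in>Pow (S - {r}). T A * forest_poly (S - A) t)"
    proof (intro sum.cong refl)
      fix A assume "A \<in> Pow (S - {r})"
      then have "forest_poly (S - A) t = t * planted_poly r (S - A) t"
        using less.prems r by (intro forest_poly_rec) auto
      then show "(\<Sum>H | H \<subseteq> S - A \<and> r \<in> H. T A * (t * (T H * forest_poly (S - A - H) t))) = T A * forest_poly (S - A) t"
        by (simp add: planted_poly_def sum_distrib_left)
    qed
    also have "(\<Sum>H | H \<subseteq> S \<and> r \<in> H. T H * forest_poly (S - H) t) +
        (\<Sum>A\<in>Pow (S - {r}). T A * forest_poly (S - A) t) = (\<Sum>A\<in>Pow S. T A * forest_poly (S - A) t)"
    proof -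
      have split: "Pow S = {H. H \<subseteq> S \<and> r \<in> H} \<union> Pow (S - {r})" by auto
      show ?thesis
        unfolding split by (rule sum.union_disjoint[symmetric]) (use less.prems in auto)
    qed
    finally show ?thesis .
  qed
qed

lemma planted_poly_deriv:
  assumes "finite S" "r \<in> S"
  shows "(planted_poly r S has_real_derivative
    (\<Sum>H | H \<subseteq> S \<and> r \<in> H. two_trees r H * forest_poly (S - H) t)) (at t)"
proof -
  have eq: "planted_poly r S = (\<lambda>t. \<Sum>H | H \<subseteq> S \<and> r \<in> H. T H * forest_poly (S - H) t)"
    by (simp add: planted_poly_def fun_eq_iff)
  have disj: "B \<union> A - B = A" if "B \<subseteq> S - A" for A B using that by blast
  have d: "(forest_poly (S - H) has_real_derivative (\<Sum>A\<in>Pow (S - H). T A * forest_poly (S - H - A) t)) (at t)" for H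
    using assms by (intro forest_poly_deriv) auto
  have "(planted_poly r S has_real_derivative
      (\<Sum>H | H \<subseteq> S \<and> r \<in> H. T H * (\<Sum>A\<in>Pow (S - H). T A * forest_poly (S - H - A) t))) (at t)"
    unfolding eq by (intro DERIV_sum DERIV_cmult d)
  also have "(\<Sum>H | H \<subseteq> S \<and> r \<in> H. T H * (\<Sum>A\<in>Pow (S - H). T A * forest_poly (S - H - A) t)) =
      (\<Sum>H | H \<subseteq> S \<and> r \<in> H. \<Sum>A\<in>Pow (S - H). T A * T H * forest_poly (S - (A \<union> H)) t)"
    by (simp add: sum_distrib_left mult_ac Diff_eq Int_ac)
  also have "\<dots> = (\<Sum>p\<in>(SIGMA H:{H. H \<subseteq> S \<and> r \<in> H}. Pow (S - H)). T (snd p) * T (fst p) * forest_poly (S - (snd p \<union> fst p)) t)"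
    by (subst sum.Sigma) (use assms in \<open>auto simp: split_def\<close>)
  \<comment> \<open>From here \<open>H\<close> is the union of the component of \<open>r\<close> and
    the marked component \<open>A\<close>, so summing over \<open>A\<close> inside \<open>H\<close>
    gives \<open>two_trees r H\<close>.\<close>
  also have "\<dots> = (\<Sum>p\<in>(SIGMA H:{H. H \<subseteq> S \<and> r \<in> H}. Pow (H - {r})). T (snd p) * T (fst p - snd p) * forest_poly (S - fst p) t)"
    by (rule sum.reindex_bij_witness[where i = "\<lambda>(H, A). (H - A, A)" and j = "\<lambda>(H, A). (A \<union> H, A)"])
       (auto simp: disj sup.absorb1)
  also have "\<dots> = (\<Sum>H | H \<subseteq> S \<and> r \<in> H. \<Sum>A\<in>Pow (H - {r}). T A * T (H - A) * forest_poly (S - H) t)"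
    by (subst sum.Sigma) (use assms finite_subset in \<open>auto simp: split_def\<close>)
  also have "\<dots> = (\<Sum>H | H \<subseteq> S \<and> r \<in> H. two_trees r H * forest_poly (S - H) t)"
    by (simp add: two_trees_def sum_distrib_right)
  finally show ?thesis .
qed

section \<open>The differential inequality and its integration\<close>

lemma trees_singleton [simp]: "trees {r} = {{}}"
proof -
  have "A = {}" if "A \<in> forests {r}" for A
    using forest_edge_cases[OF that] by blast
  moreover have "{} \<in> forests {r}" by (simp add: forests_def)
  ultimately show ?thesis by (auto simp: trees_def)
qed

text \<open>Attaching \<open>r\<close> as a leaf at \<open>z\<close> is injective, since
  \<open>r\<close> lies on no other edge of the new tree.\<close>

lemma trees_add_leaf:
  assumes "finite H" "r \<notin> H"
  shows "card (nb H r) * T H \<le> T (insert r H)"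
proof -
  let ?f = "\<lambda>(A, z). insert {r, z} A"
  have "card (trees H \<times> nb H r) \<le> card (trees (insert r H))"
  proof (rule card_inj_on_le[of ?f])
    have r: "r \<notin> e" if "A \<in> trees H" "e \<in> A" for A e
      using that assms by (auto simp: trees_def forests_def)
    show "inj_on ?f (trees H \<times> nb H r)"
    proof (rule inj_onI, clarsimp)
      fix A z A' z'
      assume A: "A \<in> trees H" "A' \<in> trees H" and eq: "insert {r, z} A = insert {r, z'} A'"
      have "{r, z} \<in> insert {r, z'} A'" "{r, z} \<notin> A'" using eq r[OF A(2)] by auto
      then have zz: "{r, z} = {r, z'}" by blast
      have "{r, z} \<notin> A" "{r, z} \<notin> A'" using r A by blast+
      with eq zz show "A = A' \<and> z = z'" by (auto simp: doubleton_eq_iff insert_ident)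
    qed
    show "?f ` (trees H \<times> nb H r) \<subseteq> trees (insert r H)"
    proof clarify
      fix A z assume A: "A \<in> trees H" and z: "z \<in> nb H r"
      have zH: "z \<in> H" using z by (simp add: nb_def)
      have Af: "A \<in> forests H" using A by (rule trees_forests)
      have "\<not> conn A z r" using conn_closed[of A z r H] Af zH assms(2) by (auto simp: forests_def)
      then have "\<not> conn A r z" using conn_sym by metis
      then have "graph_acyclic (insert {r, z} A)"
        using Af by (intro acyclic_insert) (simp_all add: forests_def)
      then have "insert {r, z} A \<in> forests (insert r H)"
        using Af z zH by (auto simp: forests_def nb_def)
      moreover have "conn (insert {r, z} A) x z" if "x \<in> insert r H" for x
        using that A zH by (auto simp: conn_insert trees_def)
      then have "conn (insert {r, z} A) x y" if "x \<in> insert r H" "y \<in> insert r H" for x y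
        using that conn_sym conn_trans by metis
      ultimately show "insert {r, z} A \<in> trees (insert r H)" by (simp add: trees_def)
    qed
  qed (use assms in simp)
  then show ?thesis unfolding card_cartesian_product by (metis mult.commute of_nat_le_iff of_nat_mult)
qed

text \<open>By \<open>planted_poly_deriv\<close> the right side is the derivative of
  \<open>planted_poly\<close>. The bound on \<open>two_trees\<close> excludes
  \<open>S = {r}\<close>; its summand \<open>1 / (2 * d)\<close> for the other \<open>S\<close>
  compensates for that.\<close>

lemma planted_poly_diff_ineq:
  assumes fin: "finite V" and r: "r \<in> V" and deg: "nb V r \<noteq> {}" and t: "0 < t" "t < 1"
  shows "planted_poly r V t / 2 < (\<Sum>S | S \<subseteq> V \<and> r \<in> S. two_trees r S * forest_poly (V - S) t)"
proof -
  define d where "d = real (card (nb V r))"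
  define P where "P = {S. S \<subseteq> V \<and> r \<in> S}"
  let ?W = "V - {r}" and ?g = "\<lambda>S. forest_poly S t"
  have d: "d > 0" using deg fin by (simp add: d_def card_gt_0_iff)
  have fP: "finite P" using fin by (simp add: P_def)
  have rP: "{r} \<in> P" using r by (simp add: P_def)
  have g0: "?g S \<ge> 0" for S using t by (simp add: forest_poly_nonneg)
  have gW: "?g ?W > 0" using fin t by (intro forest_poly_pos) auto
  define R where "R = (\<Sum>S\<in>P - {{r}}. T S * ?g (V - S))"

  \<comment> \<open>For each neighbour \<open>z\<close> of \<open>r\<close>,
    \<open>?g ?W / t\<close> splits off the component \<open>H\<close> of \<open>z\<close>.
    Attaching \<open>r\<close> to \<open>H\<close> as a leaf bounds these terms by those of
    \<open>R\<close>.\<close>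
  have "d * (?g ?W / t) = (\<Sum>z\<in>nb V r. ?g ?W / t)" by (simp add: d_def)
  also have "\<dots> = (\<Sum>z\<in>nb V r. \<Sum>H | H \<subseteq> ?W \<and> z \<in> H. T H * ?g (?W - H))"
  proof (intro sum.cong refl)
    fix z assume "z \<in> nb V r"
    then have "z \<in> ?W" using nb_not_self by (auto simp: nb_def)
    then show "?g ?W / t = (\<Sum>H | H \<subseteq> ?W \<and> z \<in> H. T H * ?g (?W - H))"
      using forest_poly_rec[of ?W z t] fin t by (simp add: planted_poly_def)
  qed
  also have "\<dots> = (\<Sum>z\<in>nb V r. \<Sum>H\<in>{H \<in> Pow ?W. z \<in> H}. T H * ?g (?W - H))"
    by (intro sum.cong refl) auto
  also have "\<dots> = (\<Sum>H\<in>Pow ?W. \<Sum>z\<in>{z \<in> nb V r. z \<in> H}. T H * ?g (?W - H))"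
    by (rule sum.swap_restrict) (use fin in auto)
  also have "\<dots> = (\<Sum>H\<in>Pow ?W. card (nb H r) * T H * ?g (?W - H))"
  proof (intro sum.cong refl)
    fix H assume "H \<in> Pow ?W"
    then have "{z \<in> nb V r. z \<in> H} = nb H r" by (auto simp: nb_def)
    then show "(\<Sum>z\<in>{z \<in> nb V r. z \<in> H}. T H * ?g (?W - H)) = card (nb H r) * T H * ?g (?W - H)" by simp
  qed
  also have "\<dots> = (\<Sum>H\<in>Pow ?W - {{}}. card (nb H r) * T H * ?g (?W - H))"
    by (rule sum.mono_neutral_right) (use fin in auto)
  also have "\<dots> \<le> (\<Sum>H\<in>Pow ?W - {{}}. T (insert r H) * ?g (V - insert r H))"
  proof (intro sum_mono)
    fix H assume "H \<in> Pow ?W - {{}}"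
    then have "finite H" "r \<notin> H" using fin finite_subset by auto
    moreover have "?W - H = V - insert r H" by auto
    ultimately show "card (nb H r) * T H * ?g (?W - H) \<le> T (insert r H) * ?g (V - insert r H)"
      using trees_add_leaf[of H r] g0 by (simp add: mult_right_mono)
  qed
  also have "\<dots> = R"
    unfolding R_def
    by (rule sum.reindex_bij_witness[where i = "\<lambda>S. S - {r}" and j = "insert r"])
       (use r in \<open>auto simp: P_def insert_absorb\<close>)
  finally have R: "d * (?g ?W / t) \<le> R" .

  have "planted_poly r V t = ?g ?W + R"
    unfolding planted_poly_def R_def P_def[symmetric]
    by (subst sum.remove[OF fP rP]) simp
  moreover have "?g ?W < R / d"
  proof -
    \<comment> \<open>The strict inequality comes from \<open>t < 1\<close>.\<close>
    have "?g ?W < ?g ?W / t" using gW t by (simp add: field_simps)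
    also have "\<dots> \<le> R / d" using R d by (simp add: field_simps)
    finally show ?thesis .
  qed
  ultimately have "planted_poly r V t / 2 < (1/2 + 1 / (2 * d)) * R"
    by (simp add: algebra_simps)
  also have "\<dots> = (\<Sum>S\<in>P - {{r}}. (1/2 + 1 / (2 * d)) * T S * ?g (V - S))"
    by (simp add: R_def sum_distrib_left mult.assoc)
  also have "\<dots> \<le> (\<Sum>S\<in>P - {{r}}. two_trees r S * ?g (V - S))"
    using two_trees_lower_bound[OF fin] g0
    by (intro sum_mono mult_right_mono) (auto simp: P_def d_def)
  \<comment> \<open>The summand of \<open>{r}\<close> may be added back, as
    \<open>two_trees r {r} = T {} * T {r} = 0\<close>.\<close>
  also have "\<dots> = (\<Sum>S\<in>P. two_trees r S * ?g (V - S))"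
    by (rule sum.mono_neutral_left) (use fP in \<open>auto simp: two_trees_def\<close>)
  finally show ?thesis unfolding P_def .
qed

text \<open>The differential inequality makes \<open>exp (- t / 2) * planted_poly r V t\<close>
  strictly increasing on the unit interval; its end values are the two sides up to the factor
  \<open>exp (1/2)\<close>.\<close>

lemma forests_gt_trees:
  assumes fin: "finite V" and r: "r \<in> V" and deg: "nb V r \<noteq> {}"
  shows "exp (1/2) * T V < card (forests V)"
proof -
  define f where "f = (\<lambda>t. exp (- t / 2) * planted_poly r V t)"
  define D where "D = (\<lambda>t. \<Sum>S | S \<subseteq> V \<and> r \<in> S. two_trees r S * forest_poly (V - S) t)"
  have deriv: "(f has_real_derivative exp (- t / 2) * (D t - planted_poly r V t / 2)) (at t)" for t
    unfolding f_def D_def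
    by (auto intro!: derivative_eq_intros planted_poly_deriv[OF fin r] simp: algebra_simps)
  have "f 0 < f 1"
  proof (rule DERIV_pos_imp_increasing_open[where f = f])
    fix t :: real assume "0 < t" "t < 1"
    then have "exp (- t / 2) * (D t - planted_poly r V t / 2) > 0"
      using planted_poly_diff_ineq[OF assms] by (simp add: D_def)
    with deriv show "\<exists>y. (f has_real_derivative y) (at t) \<and> 0 < y" by blast
  next
    show "continuous_on {0..1} f"
      by (intro continuous_at_imp_continuous_on ballI DERIV_isCont[OF deriv])
  qed simp
  moreover have "f 0 = T V"
  proof -
    \<comment> \<open>Only \<open>H = V\<close> survives, because \<open>forest_poly\<close> of a
      nonempty set vanishes at 0.\<close>
    have "f 0 = (\<Sum>H | H \<subseteq> V \<and> r \<in> H. of_bool (H = V) * T H)"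
      unfolding f_def planted_poly_def using fin
      by (auto simp: forest_poly_0 intro!: sum.cong)
    also have "\<dots> = (\<Sum>H\<in>{V}. T H)"
      by (rule sum.mono_neutral_cong_right) (use fin r in auto)
    finally show ?thesis by simp
  qed
  moreover have "f 1 = exp (- (1/2)) * card (forests V)"
    using forest_poly_rec[OF fin r, of 1] by (simp add: f_def forest_poly_1)
  ultimately show ?thesis by (simp add: exp_minus field_simps)
qed

text \<open>A minimal edge set connecting \<open>V\<close> is acyclic, as an edge that is not a
  bridge could be dropped. This makes the denominator of the ratio positive.\<close>

lemma trees_nonempty:
  assumes fin: "finite V" and V: "V \<noteq> {}" and E: "\<Union>E \<subseteq> V"
    and conn: "\<And>x y. x \<in> V \<Longrightarrow> y \<in> V \<Longrightarrow> conn E x y"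
  shows "trees V \<noteq> {}"
proof -
  let ?C = "{A. A \<subseteq> E \<and> (\<forall>x\<in>V. \<forall>y\<in>V. conn A x y)}"
  have "E \<subseteq> Pow V" using E by auto
  then have "finite E" using fin finite_subset by blast
  then have "finite ?C" by simp
  moreover have "E \<in> ?C" using conn by simp
  ultimately obtain A where A: "A \<in> ?C" and min: "\<And>B. B \<in> ?C \<Longrightarrow> B \<subseteq> A \<Longrightarrow> A = B"
    using finite_has_minimal2[of ?C E] by auto
  have "graph_acyclic A"
  proof (rule acyclic_if_bridges)
    fix x y assume xy: "{x, y} \<in> A"
    show "\<not> conn (A - {{x, y}}) x y"
    proof
      assume c: "conn (A - {{x, y}}) x y"
      have eq: "insert {x, y} (A - {{x, y}}) = A" using xy by auto
      have "conn (A - {{x, y}}) a b" if "conn A a b" for a b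
      proof -
        from that have "conn (insert {x, y} (A - {{x, y}})) a b" by (simp only: eq)
        then show ?thesis unfolding conn_insert using c conn_sym[OF c] conn_trans by metis
      qed
      then have "A - {{x, y}} \<in> ?C" using A by auto
      then have "A = A - {{x, y}}" by (intro min) auto
      with xy show False by auto
    qed
  qed
  then have "A \<in> trees V" using A V E by (auto simp: trees_def forests_def)
  then show ?thesis by auto
qed

end

theorem theorem1p5:
  fixes V :: "'a set" and E :: "'a set set"
  assumes "simple_graph V E"
    and "graph_connected V E"
    and "card V \<ge> 2"
  shows "forest_tree_ratio V E > sqrt (exp 1)"
proof -
  have fin: "finite V" and EV: "\<Union>E \<subseteq> V" and E2: "\<And>e. e \<in> E \<Longrightarrow> card e = 2"
    using assms(1) by (auto simp: simple_graph_def)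
  interpret edge_set E using E2 by unfold_locales
  have con: "conn E x y" if "x \<in> V" "y \<in> V" for x y
    using assms(2) that by (auto simp: graph_connected_def conn_def)
  have V: "V \<noteq> {}" using assms(2) by (simp add: graph_connected_def)
  then obtain r where r: "r \<in> V" by blast
  \<comment> \<open>Any vertex can serve as \<open>r\<close>; a second vertex and connectivity give
    it a neighbour.\<close>
  have "V \<noteq> {r}" using assms(3) by auto
  then obtain v where v: "v \<in> V" "v \<noteq> r" using r by blast
  obtain z where "{r, z} \<in> E" using conn_first_edge[OF con[OF r v(1)]] v(2) by blast
  then have deg: "nb V r \<noteq> {}" using EV by (auto simp: nb_def)
  have F: "spanning_forests E = forests V"
    using EV by (auto simp: spanning_forests_def forests_def)
  have T: "spanning_trees V E = trees V"
    using EV V by (auto simp: spanning_trees_def trees_def forests_def graph_connected_def conn_def)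
  have "T V > 0"
    using trees_nonempty[OF fin V EV con] fin by (simp add: card_gt_0_iff)
  then have "exp (1/2) < forest_tree_ratio V E"
    using forests_gt_trees[OF fin r deg]
    by (simp add: forest_tree_ratio_def num_forests_def num_trees_def F T field_simps)
  moreover have "sqrt (exp 1) = exp (1/2)"
    by (rule real_sqrt_unique) (simp_all add: power2_eq_square flip: exp_add)
  ultimately show ?thesis by simp
qed

end
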